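(* For every integer $m\geq 0$ and every integer $r\geq 3$, $$H_{2}\left(m,\tfrac{r-1}{r-2}\right)\cdot(r-2)^{m-2}\;\leq\;\operatorname{forb}(m,r,M)-(r-1)^m-m(r-1)^{m-1}\;\leq\; H\left(m,\tfrac{r-1}{r-2}\right)\cdot(r-2)^{m-2}.$$
   Context: An $r$-matrix is a matrix with entries in $\{0,1,\dots,r-1\}$; it is simple if its columns are pairwise distinct. A matrix $A$ contains a configuration of $F$ if some submatrix of $A$ is a row and column permutation of $F$. Let $M=\begin{bmatrix}0&1\\0&1\\1&0\end{bmatrix}$, and let $\operatorname{forb}(m,r,M)$ be the maximum number of columns of an $m$-rowed simple $r$-matrix containing no configuration of $M$. A triangular choice multigraph (TCM) $\mathcal{G}$ on a vertex set $V$ is obtained by choosing, for every 3-element subset $\{u,v,w\}\subseteq V$, exactly one of the pairs $uv,uw,vw$ and adding one copy of it as an edge. For a pair $xy$, $m^{\mathcal{G}}_{xy}$ is its multiplicity (the number of triples in which $xy$ was chosen). For real $\alpha$, $w(\mathcal{G},\alpha)=\sum_{xy\in\binom{[m]}{2}}\alpha^{m^{\mathcal{G}}_{xy}}$ for a TCM on $[m]$, and $H(m,\alpha)$ is the maximum of $w(\mathcal{G},\alpha)$ over all TCMs on $[m]$. A TCM $\mathcal{G}$ on $V$ is 2-recursive if either $|V|\in\{1,2\}$ and $\mathcal{G}$ is empty, or $|V|\geq 3$ and there is a partition $V=V_1\cup V_2$ with $V_1,V_2\neq\emptyset$ such that $\mathcal{G}=\mathcal{G}_1\cup\mathcal{G}_2\cup\mathcal{G}_3$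 (union with multiplicities), where $\mathcal{G}_i$ is a 2-recursive TCM on $V_i$ ($i=1,2$) and $\mathcal{G}_3$ consists of: for every triple with $u,v\in V_1$, $w\in V_2$ a copy of $uv$, and for every triple with $u\in V_1$, $v,w\in V_2$ a copy of $vw$. $H_2(m,\alpha)$ is the maximum of $w(\mathcal{G},\alpha)$ over all 2-recursive TCMs on $[m]$ (with $H(m,\alpha)=H_2(m,\alpha)=0$ when $m\le 1$ and the empty sum convention). *)

theory Defs
  imports
    Complex_Main
    "HOL-Library.Multiset"
    "HOL-Library.Ramsey"
    "HOL-Combinatorics.Permutations"
    "Jordan_Normal_Form.Matrix"
    "Jordan_Normal_Form.DL_Submatrix"
begin

definition is_r_matrix :: "nat \<Rightarrow> nat mat \<Rightarrow> bool" where
  "is_r_matrix r A \<longleftrightarrow> elements_mat A \<subseteq> {..<r}"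

definition simple_mat :: "'a mat \<Rightarrow> bool" where
  "simple_mat A \<longleftrightarrow> distinct (cols A)"

definition row_col_permutation :: "'a mat \<Rightarrow> 'a mat \<Rightarrow> bool" where
  "row_col_permutation B F \<longleftrightarrow>
     (\<exists>p q. p permutes {..<dim_row F} \<and> q permutes {..<dim_col F} \<and>
        B = mat (dim_row F) (dim_col F) (\<lambda>(i, j). F $$ (p i, q j)))"

definition contains_configuration :: "'a mat \<Rightarrow> 'a mat \<Rightarrow> bool" where
  "contains_configuration A F \<longleftrightarrow>
     (\<exists>I J. I \<subseteq> {..<dim_row A} \<and> J \<subseteq> {..<dim_col A} \<and>
        row_col_permutation (submatrix A I J) F)"

(* The set below is finite, since a simple m-rowed r-matrix has at most r ^ m columns. For m = 0
   all columns are equal, so a simple matrix has at most one. *)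
definition forb :: "nat \<Rightarrow> nat \<Rightarrow> nat mat \<Rightarrow> nat" where
  "forb m r F =
     Max {dim_col A | A. dim_row A = m \<and> is_r_matrix r A \<and> simple_mat A \<and>
                         \<not> contains_configuration A F}"

definition conf_M :: "nat mat" where
  "conf_M = mat_of_rows_list 2 [[0, 1],
                                [0, 1],
                                [1, 0]]"

(* A multigraph on V is given by the multiset of its edges; an edge is a 2-element subset of V and
   its multiplicity is its count. *)
definition is_TCM :: "'a set \<Rightarrow> 'a set multiset \<Rightarrow> bool" where
  "is_TCM V G \<longleftrightarrow> finite V \<and>
     (\<exists>c. (\<forall>T \<in> nsets V 3. c T \<in> nsets T 2) \<and> G = image_mset c (mset_set (nsets V 3)))"

(* One edge for each triple meeting both parts: the pair of its vertices lying in the same part. *)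
definition cross_edges :: "'a set \<Rightarrow> 'a set \<Rightarrow> 'a set multiset" where
  "cross_edges V1 V2 =
     image_mset (\<lambda>(e, w). e) (mset_set (nsets V1 2 \<times> V2)) +
     image_mset (\<lambda>(u, e). e) (mset_set (V1 \<times> nsets V2 2))"

inductive two_recursive :: "'a set \<Rightarrow> 'a set multiset \<Rightarrow> bool" where
  base: "card V \<in> {1, 2} \<Longrightarrow> two_recursive V {#}"
| split: "\<lbrakk>card V \<ge> 3; V = V1 \<union> V2; V1 \<inter> V2 = {}; V1 \<noteq> {}; V2 \<noteq> {};
           two_recursive V1 G1; two_recursive V2 G2;
           G = G1 + G2 + cross_edges V1 V2\<rbrakk> \<Longrightarrow> two_recursive V G"

definition weight :: "nat \<Rightarrow> nat set multiset \<Rightarrow> real \<Rightarrow> real" where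
  "weight m G \<alpha> = (\<Sum>e \<in> nsets {1..m} 2. \<alpha> ^ count G e)"

definition H :: "nat \<Rightarrow> real \<Rightarrow> real" where
  "H m \<alpha> = (if m \<le> 1 then 0 else Max {weight m G \<alpha> | G. is_TCM {1..m} G})"

definition H2 :: "nat \<Rightarrow> real \<Rightarrow> real" where
  "H2 m \<alpha> =
     (if m \<le> 1 then 0 else Max {weight m G \<alpha> | G. is_TCM {1..m} G \<and> two_recursive {1..m} G})"

end

(* Read the columns of a matrix as words on the rows. Only the entries 0 and 1 matter for M: a word
   has a binary support S and a pattern, the set of its 1s inside S, while the other positions carry
   r - 2 free symbols. A family avoids M iff on every triple of rows no two complementary nonconstant
   patterns occur, so at most 5 patterns occur on a triple.

   Upper bound: replacing 1s by 0s whenever this creates a new word keeps the number of words and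
   does not increase the number of patterns on any triple. In the end the patterns on each triple are
   a down-closed family of at most 5 sets, hence contain at most one pair; choosing these pairs gives
   a TCM. Every word has at most two 1s, and if the 1s are at x and y then each 0 is at a w whose
   triple xyw chose xy. These words are counted by (r-1)^m + m (r-1)^(m-1) plus the weight of the TCM.

   Lower bound: for a 2-recursive TCM, let the admissible patterns on a support S with at least three
   elements, split by V1 and V2, be those of V1 with 0s on V2 together with those of V2 with 1s on V1.
   By induction they avoid M and are, for every S, as many as the patterns counted above. *)
theory Submission
  imports Defs
begin

section \<open>Words, binary supports and patterns\<close>

definition M_free :: "'a set \<Rightarrow> ('a \<Rightarrow> nat) set \<Rightarrow> bool" where
  "M_free V \<F> \<longleftrightarrow> (\<forall>f\<in>\<F>. \<forall>g\<in>\<F>. \<forall>i\<in>V. \<forall>j\<in>V. \<forall>k\<in>V. i \<noteq> j \<longrightarrow>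
     \<not> (f i = 0 \<and> f j = 0 \<and> f k = 1 \<and> g i = 1 \<and> g j = 1 \<and> g k = 0))"

definition words :: "'a set \<Rightarrow> nat \<Rightarrow> ('a \<Rightarrow> nat) set" where
  "words V r = PiE V (\<lambda>_. {..<r})"

lemma finite_words [simp]: "finite V \<Longrightarrow> finite (words V r)"
  by (simp add: words_def finite_PiE)

(* N e stands for the set of vertices w whose triple e \<union> {w} chooses e. *)
definition complete_pairs :: "('a set \<Rightarrow> 'a set) \<Rightarrow> 'a set \<Rightarrow> 'a set set" where
  "complete_pairs N S = {e \<in> nsets S 2. S - e \<subseteq> N e}"

definition ones :: "'a set \<Rightarrow> ('a \<Rightarrow> nat) \<Rightarrow> 'a set" where
  "ones V f = {v \<in> V. f v = 1}"

definition binary_support :: "'a set \<Rightarrow> ('a \<Rightarrow> nat) \<Rightarrow> 'a set" where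
  "binary_support V f = {v \<in> V. f v \<le> 1}"

text \<open>Both bounds work with families of this form. Membership depends only on support and
  pattern, so such a family can be counted one support at a time.\<close>

definition pattern_words :: "'a set \<Rightarrow> nat \<Rightarrow> ('a set \<Rightarrow> 'a set set) \<Rightarrow> ('a \<Rightarrow> nat) set" where
  "pattern_words V r B = {f \<in> words V r. ones V f \<in> B (binary_support V f)}"

lemma count_image_mset_set:
  assumes "finite A"
  shows "count (image_mset f (mset_set A)) y = card {x \<in> A. f x = y}"
proof -
  have "count (image_mset f (mset_set A)) y = (\<Sum>x\<in>f -` {y} \<inter> A. count (mset_set A) x)"
    using assms by (simp add: count_image_mset)
  also have "\<dots> = (\<Sum>x\<in>{x \<in> A. f x = y}. 1)"
    using assms by (intro sum.cong) auto
  finally show ?thesis by simp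
qed

subsection \<open>Matrices and words\<close>

text \<open>\<open>submatrix\<close> lists the chosen rows and columns through \<open>pick\<close>;
  the bijection converts index sets into index maps.\<close>

lemma bij_betw_pick:
  assumes "finite I"
  shows "bij_betw (pick I) {..<card I} I"
proof -
  have "inj_on (pick I) {..<card I}"
    by (rule linorder_inj_onI) (use pick_mono_le in fastforce)+
  moreover have "pick I ` {..<card I} \<subseteq> I"
    by (auto intro: pick_in_set_le)
  ultimately have "pick I ` {..<card I} = I"
    using assms by (intro card_subset_eq) (auto simp: card_image)
  with \<open>inj_on (pick I) {..<card I}\<close> show ?thesis
    by (rule bij_betw_imageI)
qed

text \<open>A submatrix keeps its rows and columns in increasing order, and the permutations then
  allow every order. Index sets with permutations thus carry the same information as injective index
  maps; passing between them composes with \<open>pick\<close> or undoes it.\<close>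

lemma contains_configuration_iff:
  "contains_configuration A F \<longleftrightarrow>
     (\<exists>\<rho> \<sigma>. inj_on \<rho> {..<dim_row F} \<and> \<rho> ` {..<dim_row F} \<subseteq> {..<dim_row A} \<and>
            inj_on \<sigma> {..<dim_col F} \<and> \<sigma> ` {..<dim_col F} \<subseteq> {..<dim_col A} \<and>
            (\<forall>a<dim_row F. \<forall>b<dim_col F. A $$ (\<rho> a, \<sigma> b) = F $$ (a, b)))"
  (is "_ \<longleftrightarrow> ?R")
proof
  assume "contains_configuration A F"
  then obtain I J p q where I: "I \<subseteq> {..<dim_row A}" and J: "J \<subseteq> {..<dim_col A}"
    and p: "p permutes {..<dim_row F}" and q: "q permutes {..<dim_col F}"
    and eq: "submatrix A I J = mat (dim_row F) (dim_col F) (\<lambda>(i, j). F $$ (p i, q j))"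
    unfolding contains_configuration_def row_col_permutation_def by blast
  have sets: "{i. i < dim_row A \<and> i \<in> I} = I" "{j. j < dim_col A \<and> j \<in> J} = J"
    using I J by auto
  have cI: "card I = dim_row F" and cJ: "card J = dim_col F"
    using arg_cong[OF eq, of dim_row] arg_cong[OF eq, of dim_col]
    by (simp_all add: dim_submatrix sets)
  have pI: "bij_betw (pick I) {..<dim_row F} I" and pJ: "bij_betw (pick J) {..<dim_col F} J"
    using bij_betw_pick[of I] bij_betw_pick[of J] I J cI cJ by (auto intro: finite_subset)
  \<comment> \<open>The entry at (i, j) of the submatrix is the entry of F at (p i, q j), so row a
    of F sits in the row of the submatrix with index \<open>inv_into UNIV p a\<close>.\<close>
  have p': "bij_betw (inv_into UNIV p) {..<dim_row F} {..<dim_row F}"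
    and q': "bij_betw (inv_into UNIV q) {..<dim_col F} {..<dim_col F}"
    using p q by (simp_all add: permutes_imp_bij permutes_inv)
  have bI: "bij_betw (pick I \<circ> inv_into UNIV p) {..<dim_row F} I"
    and bJ: "bij_betw (pick J \<circ> inv_into UNIV q) {..<dim_col F} J"
    using bij_betw_trans[OF p' pI] bij_betw_trans[OF q' pJ] .
  have "A $$ ((pick I \<circ> inv_into UNIV p) a, (pick J \<circ> inv_into UNIV q) b) = F $$ (a, b)"
    if "a < dim_row F" "b < dim_col F" for a b
  proof -
    have ab: "inv_into UNIV p a < dim_row F" "inv_into UNIV q b < dim_col F"
      using bij_betwE[OF p'] bij_betwE[OF q'] that by auto
    have "A $$ (pick I (inv_into UNIV p a), pick J (inv_into UNIV q b)) = submatrix A I J $$ (inv_into UNIV p a, inv_into UNIV q b)"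
      using ab by (intro submatrix_index[symmetric]) (simp_all add: sets cI cJ)
    then show ?thesis
      using ab p q by (simp add: eq permutes_inverses)
  qed
  then show ?R
    using bI bJ I J
    by (intro exI[of _ "pick I \<circ> inv_into UNIV p"] exI[of _ "pick J \<circ> inv_into UNIV q"] conjI)
      (simp_all add: bij_betw_def)
next
  assume ?R
  then obtain \<rho> \<sigma> where \<rho>: "inj_on \<rho> {..<dim_row F}" "\<rho> ` {..<dim_row F} \<subseteq> {..<dim_row A}"
    and \<sigma>: "inj_on \<sigma> {..<dim_col F}" "\<sigma> ` {..<dim_col F} \<subseteq> {..<dim_col A}"
    and eq: "\<And>a b. a < dim_row F \<Longrightarrow> b < dim_col F \<Longrightarrow> A $$ (\<rho> a, \<sigma> b) = F $$ (a, b)"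
    by (elim exE conjE) simp
  \<comment> \<open>An injection is the increasing enumeration of its image, rearranged. The
    permutation is \<open>pick\<close> followed by the inverse of \<tau>, continued by the identity
    from n on, as \<open>permutes\<close> demands.\<close>
  have perm: "\<exists>p. p permutes {..<n} \<and> (\<forall>a<n. \<tau> (p a) = pick (\<tau> ` {..<n}) a)"
    if \<tau>: "inj_on \<tau> {..<n}" for \<tau> :: "nat \<Rightarrow> nat" and n
  proof -
    let ?I = "\<tau> ` {..<n}"
    let ?f = "\<lambda>a. inv_into {..<n} \<tau> (pick ?I a)"
    let ?p = "\<lambda>a. if a < n then ?f a else a"
    have pk: "bij_betw (pick ?I) {..<n} ?I"
      using bij_betw_pick[of ?I] \<tau> by (simp add: card_image)
    have "bij_betw ?f {..<n} {..<n}"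
      using bij_betw_trans[OF pk bij_betw_inv_into[OF bij_betw_imageI[OF \<tau> refl]]]
      by (simp add: comp_def)
    then have "bij_betw ?p {..<n} {..<n}"
      by (subst bij_betw_cong[where g = ?f]) auto
    then have "?p permutes {..<n}"
      by (rule bij_imp_permutes) auto
    moreover have "\<tau> (?p a) = pick ?I a" if "a < n" for a
      using that bij_betwE[OF pk] by (simp add: f_inv_into_f)
    ultimately show ?thesis by blast
  qed
  obtain p where p: "p permutes {..<dim_row F}"
    "\<forall>a<dim_row F. \<rho> (p a) = pick (\<rho> ` {..<dim_row F}) a" using perm[OF \<rho>(1)] by blast
  obtain q where q: "q permutes {..<dim_col F}"
    "\<forall>a<dim_col F. \<sigma> (q a) = pick (\<sigma> ` {..<dim_col F}) a" using perm[OF \<sigma>(1)] by blast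
  let ?I = "\<rho> ` {..<dim_row F}" and ?J = "\<sigma> ` {..<dim_col F}"
  have "{i. i < dim_row A \<and> i \<in> ?I} = ?I" "{j. j < dim_col A \<and> j \<in> ?J} = ?J"
    using \<rho>(2) \<sigma>(2) by auto
  then have dims: "card {i. i < dim_row A \<and> i \<in> ?I} = dim_row F"
    "card {j. j < dim_col A \<and> j \<in> ?J} = dim_col F"
    using \<rho>(1) \<sigma>(1) by (simp_all add: card_image)
  have "submatrix A ?I ?J = mat (dim_row F) (dim_col F) (\<lambda>(i, j). F $$ (p i, q j))"
  proof (rule eq_matI)
    fix i j
    assume "i < dim_row (mat (dim_row F) (dim_col F) (\<lambda>(i, j). F $$ (p i, q j)))"
      and "j < dim_col (mat (dim_row F) (dim_col F) (\<lambda>(i, j). F $$ (p i, q j)))"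
    then have ij: "i < dim_row F" "j < dim_col F" by simp_all
    have pq: "p i < dim_row F" "q j < dim_col F"
      using permutes_in_image[OF p(1), of i] permutes_in_image[OF q(1), of j] ij by auto
    have "submatrix A ?I ?J $$ (i, j) = A $$ (\<rho> (p i), \<sigma> (q j))"
      using ij p(2) q(2) by (subst submatrix_index) (simp_all add: dims)
    also have "\<dots> = F $$ (p i, q j)" using eq pq .
    finally show "submatrix A ?I ?J $$ (i, j) =
        mat (dim_row F) (dim_col F) (\<lambda>(i, j). F $$ (p i, q j)) $$ (i, j)"
      using ij by simp
  qed (simp_all add: dim_submatrix dims)
  then show "contains_configuration A F"
    using \<rho>(2) \<sigma>(2) p(1) q(1)
    unfolding contains_configuration_def row_col_permutation_def by blast
qed

lemma conf_M_dims [simp]: "dim_row conf_M = 3" "dim_col conf_M = 2"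
  by (simp_all add: conf_M_def mat_of_rows_list_def)

lemma conf_M_entries:
  "conf_M $$ (0, 0) = 0" "conf_M $$ (0, Suc 0) = 1"
  "conf_M $$ (Suc 0, 0) = 0" "conf_M $$ (Suc 0, Suc 0) = 1"
  "conf_M $$ (2, 0) = 1" "conf_M $$ (2, Suc 0) = 0"
  by (simp_all add: conf_M_def mat_of_rows_list_def)

text \<open>The row 10 of M cannot coincide with a row 01, and the two columns differ. So the
  entries themselves enforce all injectivity except between the two equal rows of M, hence the
  single condition \<open>i \<noteq> j\<close>, as in \<open>M_free\<close>.\<close>

lemma contains_conf_M_iff:
  "contains_configuration A conf_M \<longleftrightarrow>
     (\<exists>i j k x y. i < dim_row A \<and> j < dim_row A \<and> k < dim_row A \<and> i \<noteq> j \<and>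
        x < dim_col A \<and> y < dim_col A \<and> A $$ (i, x) = 0 \<and> A $$ (j, x) = 0 \<and> A $$ (k, x) = 1 \<and>
        A $$ (i, y) = 1 \<and> A $$ (j, y) = 1 \<and> A $$ (k, y) = 0)"
  (is "_ \<longleftrightarrow> ?R")
proof -
  have l3: "{..<3} = {0, Suc 0, 2}" and l2: "{..<2} = {0, Suc 0}" by auto
  have a3: "(\<forall>a<3. P a) \<longleftrightarrow> P 0 \<and> P (Suc 0) \<and> P 2" for P
    by (simp add: eval_nat_numeral All_less_Suc conj_ac)
  have a2: "(\<forall>a<2. P a) \<longleftrightarrow> P 0 \<and> P (Suc 0)" for P
    by (simp add: eval_nat_numeral All_less_Suc conj_ac)
  show ?thesis
  proof
    assume "contains_configuration A conf_M"
    then obtain \<rho> \<sigma> where "inj_on \<rho> {0, Suc 0, 2}" "\<rho> ` {0, Suc 0, 2} \<subseteq> {..<dim_row A}"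
       "\<sigma> ` {0, Suc 0} \<subseteq> {..<dim_col A}"
       "\<forall>a<3. \<forall>b<2. A $$ (\<rho> a, \<sigma> b) = conf_M $$ (a, b)"
      unfolding contains_configuration_iff conf_M_dims l2 l3 by auto
    then have "\<rho> 0 < dim_row A \<and> \<rho> (Suc 0) < dim_row A \<and> \<rho> 2 < dim_row A \<and> \<rho> 0 \<noteq> \<rho> (Suc 0) \<and>
      \<sigma> 0 < dim_col A \<and> \<sigma> (Suc 0) < dim_col A \<and> A $$ (\<rho> 0, \<sigma> 0) = 0 \<and>
      A $$ (\<rho> (Suc 0), \<sigma> 0) = 0 \<and> A $$ (\<rho> 2, \<sigma> 0) = 1 \<and> A $$ (\<rho> 0, \<sigma> (Suc 0)) = 1 \<and>
      A $$ (\<rho> (Suc 0), \<sigma> (Suc 0)) = 1 \<and> A $$ (\<rho> 2, \<sigma> (Suc 0)) = 0"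
      unfolding a3 a2 conf_M_entries by (simp add: inj_on_def)
    then show ?R by (intro exI)
  next
    assume ?R
    then obtain i j k x y where *: "i < dim_row A" "j < dim_row A" "k < dim_row A" "i \<noteq> j"
      "x < dim_col A" "y < dim_col A" "A $$ (i, x) = 0" "A $$ (j, x) = 0" "A $$ (k, x) = 1"
      "A $$ (i, y) = 1" "A $$ (j, y) = 1" "A $$ (k, y) = 0"
      by blast
    define \<rho> where "\<rho> = (\<lambda>_::nat. k)(0 := i, Suc 0 := j)"
    define \<sigma> where "\<sigma> = (\<lambda>_::nat. y)(0 := x)"
    have vals: "\<rho> 0 = i" "\<rho> (Suc 0) = j" "\<rho> 2 = k" "\<sigma> 0 = x" "\<sigma> (Suc 0) = y"
      by (simp_all add: \<rho>_def \<sigma>_def)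
    have "i \<noteq> k" "j \<noteq> k" "x \<noteq> y" using * by auto
    then have "inj_on \<rho> {0, Suc 0, 2} \<and> \<rho> ` {0, Suc 0, 2} \<subseteq> {..<dim_row A} \<and>
      inj_on \<sigma> {0, Suc 0} \<and> \<sigma> ` {0, Suc 0} \<subseteq> {..<dim_col A} \<and>
      (\<forall>a<3. \<forall>b<2. A $$ (\<rho> a, \<sigma> b) = conf_M $$ (a, b))"
      unfolding a3 a2 conf_M_entries using * by (simp add: inj_on_def vals)
    then show "contains_configuration A conf_M"
      unfolding contains_configuration_iff conf_M_dims l2 l3 by (intro exI)
  qed
qed

text \<open>Matrix rows are numbered from 0 whereas the TCMs live on \<open>{1..m}\<close>, hence
  the shift by one. The value outside is \<open>undefined\<close>, as membership in
  \<open>words\<close> requires.\<close>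

definition col_word :: "nat mat \<Rightarrow> nat \<Rightarrow> nat \<Rightarrow> nat" where
  "col_word A j = (\<lambda>v\<in>{1..dim_row A}. A $$ (v - 1, j))"

lemma col_word_apply: "i < dim_row A \<Longrightarrow> col_word A j (Suc i) = A $$ (i, j)"
  by (simp add: col_word_def)

lemma inj_on_col_word:
  assumes "simple_mat A"
  shows "inj_on (col_word A) {..<dim_col A}"
proof (rule inj_onI)
  fix x y assume xy: "x \<in> {..<dim_col A}" "y \<in> {..<dim_col A}" and eq: "col_word A x = col_word A y"
  have "A $$ (i, x) = A $$ (i, y)" if "i < dim_row A" for i
    using col_word_apply[OF that, of x] col_word_apply[OF that, of y] eq by simp
  then have "cols A ! x = cols A ! y"
    using xy by (auto intro!: eq_vecI)
  then show "x = y"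
    using assms xy by (metis cols_length lessThan_iff nth_eq_iff_index_eq simple_mat_def)
qed

lemma M_free_col_words_iff:
  "M_free {1..dim_row A} (col_word A ` {..<dim_col A}) \<longleftrightarrow> \<not> contains_configuration A conf_M"
proof -
  have rows: "(\<forall>i\<in>{1..dim_row A}. P i) \<longleftrightarrow> (\<forall>i<dim_row A. P (Suc i))" for P
    unfolding image_Suc_lessThan[symmetric] by blast
  let ?M = "\<lambda>x y i j k. A $$ (i, x) = 0 \<and> A $$ (j, x) = 0 \<and> A $$ (k, x) = 1 \<and>
      A $$ (i, y) = 1 \<and> A $$ (j, y) = 1 \<and> A $$ (k, y) = 0"
  have "M_free {1..dim_row A} (col_word A ` {..<dim_col A}) \<longleftrightarrow>
    (\<forall>x<dim_col A. \<forall>y<dim_col A. \<forall>i<dim_row A. \<forall>j<dim_row A. \<forall>k<dim_row A. i \<noteq> j \<longrightarrow> \<not> ?M x y i j k)"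
    unfolding M_free_def rows
    unfolding ball_simps(9)
    unfolding Ball_def lessThan_iff
    by (simp only: col_word_apply nat.inject cong: imp_cong)
  also have "\<dots> \<longleftrightarrow> \<not> (\<exists>i j k x y. i < dim_row A \<and> j < dim_row A \<and> k < dim_row A \<and> i \<noteq> j \<and>
      x < dim_col A \<and> y < dim_col A \<and> ?M x y i j k)"
    by (simp only: not_ex de_Morgan_conj imp_conv_disj disj_assoc not_not) blast
  also have "\<dots> \<longleftrightarrow> \<not> contains_configuration A conf_M"
    unfolding contains_conf_M_iff ..
  finally show ?thesis .
qed

lemma M_free_family_of_matrix:
  assumes "is_r_matrix r A" "simple_mat A" "\<not> contains_configuration A conf_M" "dim_row A = m"
  shows "\<exists>\<F> \<subseteq> words {1..m} r. M_free {1..m} \<F> \<and> card \<F> = dim_col A"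
proof (intro exI conjI)
  show "col_word A ` {..<dim_col A} \<subseteq> words {1..m} r"
  proof
    fix f assume "f \<in> col_word A ` {..<dim_col A}"
    then obtain j where j: "j < dim_col A" "f = col_word A j" by blast
    have "A $$ (v - 1, j) \<in> {..<r}" if "v \<in> {1..m}" for v
      using assms(1,4) j(1) that elements_matI[of A "dim_row A" "dim_col A" "v - 1" j]
      unfolding is_r_matrix_def by fastforce
    then show "f \<in> words {1..m} r"
      using assms(4) by (auto simp: j(2) words_def col_word_def)
  qed
  show "M_free {1..m} (col_word A ` {..<dim_col A})"
    using assms M_free_col_words_iff by auto
  show "card (col_word A ` {..<dim_col A}) = dim_col A"
    using inj_on_col_word[OF assms(2)] by (simp add: card_image)
qed

lemma matrix_of_M_free_family:
  assumes "\<F> \<subseteq> words {1..m} r" "M_free {1..m} \<F>"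
  obtains A where "dim_row A = m" "is_r_matrix r A" "simple_mat A"
    "\<not> contains_configuration A conf_M" "dim_col A = card \<F>"
proof -
  have "finite \<F>" using assms(1) by (rule finite_subset) simp
  then obtain h where h: "bij_betw h {..<card \<F>} \<F>"
    using ex_bij_betw_nat_finite lessThan_atLeast0 by metis
  define A where "A = mat m (card \<F>) (\<lambda>(i, j). h j (Suc i))"
  have dims: "dim_row A = m" "dim_col A = card \<F>" by (simp_all add: A_def)
  have hw: "h j \<in> words {1..m} r" if "j < card \<F>" for j
    using h assms(1) that by (auto simp: bij_betw_def)
  have cw: "col_word A j = h j" if "j < card \<F>" for j
  proof
    fix v
    show "col_word A j v = h j v"
      using hw[OF that] that by (cases "v \<in> {1..m}") (auto simp: col_word_def A_def words_def)
  qed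
  have "col_word A ` {..<dim_col A} = \<F>"
    using h cw dims by (auto simp: bij_betw_def)
  then have "\<not> contains_configuration A conf_M"
    using assms(2) dims M_free_col_words_iff by metis
  moreover have "is_r_matrix r A"
    unfolding is_r_matrix_def
  proof
    fix a assume "a \<in> elements_mat A"
    then obtain i j where "i < m" "j < card \<F>" "a = A $$ (i, j)"
      using dims elements_matD by metis
    then show "a \<in> {..<r}"
      using hw[of j] by (auto simp: A_def words_def PiE_def Pi_def)
  qed
  moreover have "simple_mat A"
    unfolding simple_mat_def distinct_conv_nth
  proof (intro allI impI)
    fix i j assume ij: "i < length (cols A)" "j < length (cols A)" "i \<noteq> j"
    show "cols A ! i \<noteq> cols A ! j"
    proof
      assume "cols A ! i = cols A ! j"
      then have "col A i = col A j" using ij by simp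
      then have "A $$ (a, i) = A $$ (a, j)" if "a < m" for a
        using that ij dims by (metis cols_length index_col)
      then have "col_word A i = col_word A j"
        by (auto simp: col_word_def dims intro!: restrict_ext)
      then show False
        using h cw ij dims by (auto simp: bij_betw_def inj_on_def)
    qed
  qed
  ultimately show thesis using that dims by blast
qed

text \<open>This turns \<open>forb\<close> into an extremal number for families of words. The
  maximum exists because the number of words bounds the set and the empty family gives a matrix
  without columns.\<close>

lemma forb_conf_M_props:
  shows forb_conf_M_attained: "\<exists>\<F> \<subseteq> words {1..m} r. M_free {1..m} \<F> \<and> card \<F> = forb m r conf_M"
    and le_forb_conf_M: "\<And>\<F>. \<F> \<subseteq> words {1..m} r \<Longrightarrow> M_free {1..m} \<F> \<Longrightarrow> card \<F> \<le> forb m r conf_M"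
proof -
  let ?S = "{dim_col A | A. dim_row A = m \<and> is_r_matrix r A \<and> simple_mat A \<and>
                         \<not> contains_configuration A conf_M}"
  have "?S \<subseteq> {..card (words {1..m} r)}"
  proof
    fix n assume "n \<in> ?S"
    then obtain A where "n = dim_col A" "dim_row A = m" "is_r_matrix r A" "simple_mat A"
      "\<not> contains_configuration A conf_M" by blast
    then obtain \<F> where "\<F> \<subseteq> words {1..m} r" "card \<F> = n"
      using M_free_family_of_matrix by metis
    then show "n \<in> {..card (words {1..m} r)}"
      by (auto intro!: card_mono)
  qed
  then have fin: "finite ?S" by (rule finite_subset) simp
  have mem: "card \<F> \<in> ?S" if "\<F> \<subseteq> words {1..m} r" "M_free {1..m} \<F>" for \<F>
    using matrix_of_M_free_family[OF that] by (smt (verit) mem_Collect_eq)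
  have "?S \<noteq> {}" using mem[of "{}"] by (auto simp: M_free_def)
  then have "forb m r conf_M \<in> ?S" unfolding forb_def using fin by (rule Max_in[rotated])
  then show "\<exists>\<F> \<subseteq> words {1..m} r. M_free {1..m} \<F> \<and> card \<F> = forb m r conf_M"
    using M_free_family_of_matrix by (smt (verit) mem_Collect_eq)
  show "card \<F> \<le> forb m r conf_M" if "\<F> \<subseteq> words {1..m} r" "M_free {1..m} \<F>" for \<F>
    unfolding forb_def using Max_ge[OF fin mem[OF that]] .
qed

subsection \<open>Counting words by their binary pattern\<close>

text \<open>Weighted binomial theorem: an element of \<open>Y - X\<close> lies in S, with factor 1,
  or does not, with factor q. The elements of V outside Y always give the factor q.\<close>

lemma sum_interval_power:
  fixes q :: real
  assumes "finite V" "X \<subseteq> Y" "Y \<subseteq> V"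
  shows "(\<Sum>S | X \<subseteq> S \<and> S \<subseteq> Y. q ^ (card V - card S)) =
    q ^ (card V - card Y) * (q + 1) ^ (card Y - card X)"
proof -
  have fY: "finite Y" using assms finite_subset by blast
  have fX: "finite X" using assms fY finite_subset by blast
  have card: "card V - card (Z \<union> X) = (card V - card Y) + card ((Y - X) - Z)"
    if "Z \<subseteq> Y - X" for Z
  proof -
    have "card (Z \<union> X) = card Z + card X"
      using that fX fY by (intro card_Un_disjoint) (auto intro: finite_subset)
    moreover have "card ((Y - X) - Z) = card Y - card X - card Z"
      using that assms fX fY by (simp add: card_Diff_subset finite_subset)
    moreover have "card Z + card X \<le> card Y"
      using that assms fY calculation(1) by (metis Diff_subset Un_least card_mono order_trans)
    moreover have "card Y \<le> card V" using assms by (simp add: card_mono)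
    ultimately show ?thesis by simp
  qed
  have "bij_betw (\<lambda>Z. Z \<union> X) (Pow (Y - X)) {S. X \<subseteq> S \<and> S \<subseteq> Y}"
    using assms(2) by (intro bij_betw_byWitness[where f' = "\<lambda>S. S - X"]) auto
  then have "(\<Sum>S | X \<subseteq> S \<and> S \<subseteq> Y. q ^ (card V - card S)) =
      (\<Sum>Z\<in>Pow (Y - X). q ^ (card V - card (Z \<union> X)))"
    by (simp add: sum.reindex_bij_betw[symmetric])
  also have "\<dots> = (\<Sum>Z\<in>Pow (Y - X). q ^ (card V - card Y) * q ^ card ((Y - X) - Z))"
    by (intro sum.cong refl) (simp only: card Pow_iff power_add)
  also have "\<dots> = q ^ (card V - card Y) * (q + 1) ^ card (Y - X)"
    using prod_add[of "Y - X" "\<lambda>_. 1" "\<lambda>_. q"] fY by (simp add: sum_distrib_left add.commute)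
  also have "card (Y - X) = card Y - card X"
    using assms(2) fX by (simp add: card_Diff_subset)
  finally show ?thesis .
qed

text \<open>Double counting of the pairs (S, x) in the relation R, each with weight
  \<open>g S\<close>.\<close>

lemma sum_card_mult:
  fixes g :: "'a set \<Rightarrow> real"
  assumes "finite V" "finite P"
  shows "(\<Sum>S\<in>Pow V. real (card {x \<in> P. R S x}) * g S) = (\<Sum>x\<in>P. \<Sum>S | S \<subseteq> V \<and> R S x. g S)"
proof -
  have "(\<Sum>S\<in>Pow V. real (card {x \<in> P. R S x}) * g S) = (\<Sum>S\<in>Pow V. \<Sum>x | x \<in> P \<and> R S x. g S)"
    by simp
  also have "\<dots> = (\<Sum>x\<in>P. \<Sum>S | S \<in> Pow V \<and> R S x. g S)"
    using assms by (intro sum.swap_restrict) auto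
  finally show ?thesis by (simp add: Pow_def)
qed

text \<open>The three summands count supports S, supports with a marked element, and supports with a
  marked pair e such that S lies between e and \<open>e \<union> N e\<close>. After an exchange of
  sums each becomes an interval sum. Where an exponent of \<open>powi\<close> is negative, the
  factor in front is 0, since V is empty or has no pairs.\<close>

lemma sum_complete_pairs:
  fixes q :: real
  assumes V: "finite V" and N: "\<And>e. e \<in> nsets V 2 \<Longrightarrow> N e \<subseteq> V - e"
    and cN: "\<And>e. e \<in> nsets V 2 \<Longrightarrow> card (N e) = c e" and q: "q > 0"
  shows "(\<Sum>S\<in>Pow V. real (1 + card S + card (complete_pairs N S)) * q ^ (card V - card S)) =
    (q + 1) ^ card V + real (card V) * (q + 1) powi (int (card V) - 1) +
    (\<Sum>e\<in>nsets V 2. ((q + 1) / q) ^ c e) * q powi (int (card V) - 2)"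
proof -
  let ?n = "card V" and ?g = "\<lambda>S. q ^ (card V - card S)"
  have "(\<Sum>S\<in>Pow V. ?g S) = (q + 1) ^ ?n"
    using sum_interval_power[OF V, of "{}" V q] by (simp add: Pow_def)
  moreover have "(\<Sum>S\<in>Pow V. real (card S) * ?g S) = real ?n * (q + 1) powi (int ?n - 1)"
  proof -
    have "(\<Sum>S\<in>Pow V. real (card S) * ?g S) = (\<Sum>S\<in>Pow V. real (card {x \<in> V. x \<in> S}) * ?g S)"
      by (intro sum.cong refl arg_cong2[of _ _ _ _ "(*)"] arg_cong[of _ _ real] arg_cong[of _ _ card]) auto
    also have "\<dots> = (\<Sum>x\<in>V. \<Sum>S | S \<subseteq> V \<and> x \<in> S. ?g S)"
      using V by (rule sum_card_mult) (use V in simp)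
    also have "\<dots> = (\<Sum>x\<in>V. (q + 1) powi (int ?n - 1))"
    proof (intro sum.cong refl)
      fix x assume x: "x \<in> V"
      then have "?n \<ge> 1" using V by (metis One_nat_def Suc_leI card_gt_0_iff empty_iff)
      moreover have "(\<Sum>S | S \<subseteq> V \<and> x \<in> S. ?g S) = (q + 1) ^ (?n - 1)"
        using sum_interval_power[OF V, of "{x}" V q] x by (simp add: conj_commute)
      ultimately show "(\<Sum>S | S \<subseteq> V \<and> x \<in> S. ?g S) = (q + 1) powi (int ?n - 1)"
        by (simp add: power_int_def nat_diff_distrib)
    qed
    finally show ?thesis by simp
  qed
  moreover have "(\<Sum>S\<in>Pow V. real (card (complete_pairs N S)) * ?g S) =
    (\<Sum>e\<in>nsets V 2. ((q + 1) / q) ^ c e) * q powi (int ?n - 2)"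
  proof -
    have "(\<Sum>S\<in>Pow V. real (card (complete_pairs N S)) * ?g S) =
      (\<Sum>S\<in>Pow V. real (card {e \<in> nsets V 2. e \<subseteq> S \<and> S - e \<subseteq> N e}) * ?g S)"
      unfolding complete_pairs_def nsets_def
      by (intro sum.cong refl arg_cong2[of _ _ _ _ "(*)"] arg_cong[of _ _ real] arg_cong[of _ _ card]) auto
    also have "\<dots> = (\<Sum>e\<in>nsets V 2. \<Sum>S | S \<subseteq> V \<and> e \<subseteq> S \<and> S - e \<subseteq> N e. ?g S)"
      using V by (intro sum_card_mult) (simp_all add: finite_imp_finite_nsets)
    also have "\<dots> = (\<Sum>e\<in>nsets V 2. ((q + 1) / q) ^ c e * q powi (int ?n - 2))"
    proof (intro sum.cong refl)
      fix e assume e: "e \<in> nsets V 2"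
      then have e': "e \<subseteq> V" "card e = 2" "finite e" by (auto simp: nsets_def)
      have "finite (N e)" using N[OF e] V by (meson Diff_subset finite_subset)
      then have cU: "card (e \<union> N e) = 2 + c e"
        using N[OF e] e' cN[OF e] by (subst card_Un_disjoint) auto
      have le: "2 + c e \<le> ?n"
        using N[OF e] e' cU V by (metis Diff_subset Un_least card_mono order_trans)
      have "{S. S \<subseteq> V \<and> e \<subseteq> S \<and> S - e \<subseteq> N e} = {S. e \<subseteq> S \<and> S \<subseteq> e \<union> N e}"
        using N[OF e] e' by auto
      then have "(\<Sum>S | S \<subseteq> V \<and> e \<subseteq> S \<and> S - e \<subseteq> N e. ?g S) =
          q ^ (?n - (2 + c e)) * (q + 1) ^ c e"
        using sum_interval_power[OF V, of e "e \<union> N e" q] N[OF e] e' cU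
        by (metis (no_types, lifting) Diff_subset Un_least Un_upper1 add_diff_cancel_left' order_trans)
      \<comment> \<open>Pulling out the power n - 2 of q leaves the base (q + 1) / q. For q = r - 2
        this is the argument at which the weights of TCMs are taken.\<close>
      also have "\<dots> = ((q + 1) / q) ^ c e * q ^ (?n - 2)"
        using q le power_add[of q "?n - (2 + c e)" "c e"] by (simp add: power_divide field_simps)
      also have "q ^ (?n - 2) = q powi (int ?n - 2)"
        using le by (simp add: power_int_def nat_diff_distrib)
      finally show "(\<Sum>S | S \<subseteq> V \<and> e \<subseteq> S \<and> S - e \<subseteq> N e. ?g S) =
        ((q + 1) / q) ^ c e * q powi (int ?n - 2)" .
    qed
    finally show ?thesis by (simp add: sum_distrib_right)
  qed
  ultimately show ?thesis
    by (simp add: distrib_right sum.distrib)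
qed

text \<open>A word amounts to its support S, its pattern, and its entries on \<open>V - S\<close>,
  which range over the r - 2 symbols from 2 on.\<close>

lemma card_pattern_words:
  assumes V: "finite V" and r: "r \<ge> 2" and B: "\<And>S. S \<subseteq> V \<Longrightarrow> B S \<subseteq> Pow S"
  shows "card (pattern_words V r B) = (\<Sum>S\<in>Pow V. card (B S) * (r - 2) ^ (card V - card S))"
proof -
  let ?T = "SIGMA S:Pow V. B S \<times> PiE (V - S) (\<lambda>_. {2..<r})"
  let ?f = "\<lambda>f. (binary_support V f, ones V f, restrict f (V - binary_support V f))"
  \<comment> \<open>The inverse writes 1 on the pattern and 0 on the rest of the support. Outside V
    the value is that of h, which is \<open>undefined\<close> there.\<close>
  let ?g = "\<lambda>(S, Z, h) v. if v \<in> S then (if v \<in> Z then 1 else 0) else h v"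
  have "bij_betw ?f (pattern_words V r B) ?T"
  proof (rule bij_betw_byWitness[where f' = ?g])
    show "\<forall>f\<in>pattern_words V r B. ?g (?f f) = f"
    proof
      fix f assume "f \<in> pattern_words V r B"
      then have "v \<notin> V \<Longrightarrow> f v = undefined" for v
        by (auto simp: pattern_words_def words_def)
      then show "?g (?f f) = f"
        by (auto simp: fun_eq_iff binary_support_def ones_def restrict_def)
    qed
    show "\<forall>x\<in>?T. ?f (?g x) = x"
    proof
      fix x assume "x \<in> ?T"
      then obtain S Z h where x: "x = (S, Z, h)" "S \<subseteq> V" "Z \<in> B S" "h \<in> PiE (V - S) (\<lambda>_. {2..<r})"
        by auto
      then have Z: "Z \<subseteq> S" using B[OF x(2)] by auto
      from x have h: "v \<in> V - S \<Longrightarrow> h v \<ge> 2" "v \<notin> V - S \<Longrightarrow> h v = undefined" for v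
        by (auto simp: PiE_def Pi_def extensional_def)
      have "binary_support V (?g x) = S" "ones V (?g x) = Z"
        using x(2) Z h(1) by (force simp: x(1) binary_support_def ones_def split: if_splits)+
      moreover have "restrict (?g x) (V - S) = h"
        using h(2) by (auto simp: x(1) fun_eq_iff restrict_def)
      ultimately show "?f (?g x) = x" using x(1) by simp
    qed
    show "?f ` pattern_words V r B \<subseteq> ?T"
    proof
      fix x assume "x \<in> ?f ` pattern_words V r B"
      then obtain f where f: "x = ?f f" "f \<in> words V r" "ones V f \<in> B (binary_support V f)"
        by (auto simp: pattern_words_def)
      moreover have "restrict f (V - binary_support V f) \<in> PiE (V - binary_support V f) (\<lambda>_. {2..<r})"
        using f(2) by (intro restrict_PiE_iff[THEN iffD2]) (auto simp: words_def binary_support_def)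
      ultimately show "x \<in> ?T" by (auto simp: binary_support_def)
    qed
    show "?g ` ?T \<subseteq> pattern_words V r B"
    proof
      fix f assume "f \<in> ?g ` ?T"
      then obtain S Z h where x: "f = ?g (S, Z, h)" "S \<subseteq> V" "Z \<in> B S"
        "h \<in> PiE (V - S) (\<lambda>_. {2..<r})"
        by auto
      then have Z: "Z \<subseteq> S" using B[OF x(2)] by auto
      from x have h: "v \<in> V - S \<Longrightarrow> h v \<ge> 2 \<and> h v < r" "v \<notin> V - S \<Longrightarrow> h v = undefined" for v
        by (auto simp: PiE_def Pi_def extensional_def)
      have "binary_support V f = S" "ones V f = Z"
        using x(2) Z h(1) by (force simp: x(1) binary_support_def ones_def split: if_splits)+
      moreover have "f \<in> words V r"
        using x(2) h r by (auto simp: x(1) words_def PiE_def Pi_def extensional_def)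
      ultimately show "f \<in> pattern_words V r B" using x(3) by (simp add: pattern_words_def)
    qed
  qed
  then have "card (pattern_words V r B) = card ?T" by (rule bij_betw_same_card)
  also have "\<dots> = (\<Sum>S\<in>Pow V. card (B S \<times> PiE (V - S) (\<lambda>_. {2..<r})))"
    using V B by (intro card_SigmaI) (auto intro!: finite_PiE intro: finite_subset[OF B] finite_subset)
  also have "\<dots> = (\<Sum>S\<in>Pow V. card (B S) * (r - 2) ^ (card V - card S))"
    using V by (intro sum.cong refl) (simp add: card_cartesian_product card_PiE card_Diff_subset finite_subset)
  finally show ?thesis .
qed

text \<open>The count shared by both bounds: q = r - 2 is positive because r \<ge> 3. When
  \<open>c e\<close> is the multiplicity of e in a TCM, the last sum is the weight of that
  TCM.\<close>

lemma card_pattern_words_complete_pairs: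
  assumes "finite V" "r \<ge> 3" "\<And>S. S \<subseteq> V \<Longrightarrow> B S \<subseteq> Pow S"
    and card: "\<And>S. S \<subseteq> V \<Longrightarrow> card (B S) = 1 + card S + card (complete_pairs N S)"
    and "\<And>e. e \<in> nsets V 2 \<Longrightarrow> N e \<subseteq> V - e" "\<And>e. e \<in> nsets V 2 \<Longrightarrow> card (N e) = c e"
  shows "real (card (pattern_words V r B)) =
    (real r - 1) ^ card V + real (card V) * (real r - 1) powi (int (card V) - 1) +
    (\<Sum>e\<in>nsets V 2. ((real r - 1) / (real r - 2)) ^ c e) * (real r - 2) powi (int (card V) - 2)"
proof -
  have "real (card (pattern_words V r B)) =
      (\<Sum>S\<in>Pow V. real (1 + card S + card (complete_pairs N S)) * (real r - 2) ^ (card V - card S))"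
    using assms(2) card_pattern_words[OF assms(1) _ assms(3), of r] by (simp add: of_nat_diff card algebra_simps)
  then show ?thesis
    using sum_complete_pairs[OF assms(1,5,6), of "real r - 2"] assms(2) by simp
qed

subsection \<open>The lower bound\<close>

text \<open>Two words with different supports can still form M on three rows common to both
  supports, so S and S' vary independently.\<close>

definition pattern_free :: "'a set \<Rightarrow> ('a set \<Rightarrow> 'a set set) \<Rightarrow> bool" where
  "pattern_free V B \<longleftrightarrow> (\<forall>S S' Z Z' i j k. S \<subseteq> V \<longrightarrow> S' \<subseteq> V \<longrightarrow> Z \<in> B S \<longrightarrow> Z' \<in> B S' \<longrightarrow>
     i \<in> S \<inter> S' \<longrightarrow> j \<in> S \<inter> S' \<longrightarrow> k \<in> S \<inter> S' \<longrightarrow> i \<noteq> j \<longrightarrow>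
     \<not> (i \<notin> Z \<and> j \<notin> Z \<and> k \<in> Z \<and> i \<in> Z' \<and> j \<in> Z' \<and> k \<notin> Z'))"

lemma M_free_pattern_words:
  assumes "pattern_free V B"
  shows "M_free V (pattern_words V r B)"
  unfolding M_free_def
proof (intro ballI impI notI)
  fix f g i j k
  assume f: "f \<in> pattern_words V r B" and g: "g \<in> pattern_words V r B"
    and V: "i \<in> V" "j \<in> V" "k \<in> V" and "i \<noteq> j"
    and vals: "f i = 0 \<and> f j = 0 \<and> f k = 1 \<and> g i = 1 \<and> g j = 1 \<and> g k = 0"
  have B: "ones V f \<in> B (binary_support V f)" "ones V g \<in> B (binary_support V g)"
    using f g by (simp_all add: pattern_words_def)
  have S: "binary_support V f \<subseteq> V" "binary_support V g \<subseteq> V"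
    by (auto simp: binary_support_def)
  have mem: "i \<in> binary_support V f \<inter> binary_support V g"
    "j \<in> binary_support V f \<inter> binary_support V g" "k \<in> binary_support V f \<inter> binary_support V g"
    using V vals by (simp_all add: binary_support_def)
  show False
    using assms[unfolded pattern_free_def, rule_format, OF S B mem \<open>i \<noteq> j\<close>] V vals
    by (simp add: ones_def)
qed

definition realizes :: "'a set \<Rightarrow> 'a set multiset \<Rightarrow> ('a set \<Rightarrow> 'a set) \<Rightarrow> ('a set \<Rightarrow> 'a set set) \<Rightarrow> bool" where
  "realizes V G N B \<longleftrightarrow> finite V \<and> set_mset G \<subseteq> nsets V 2 \<and>
     (\<forall>e\<in>nsets V 2. N e \<subseteq> V - e \<and> card (N e) = count G e) \<and>
     (\<forall>S\<subseteq>V. B S \<subseteq> Pow S \<and> {} \<in> B S \<and> S \<in> B S \<and> card (B S) = 1 + card S + card (complete_pairs N S)) \<and>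
     pattern_free V B"

lemma realizes_small:
  assumes "finite V" "card V \<le> 2"
  shows "realizes V {#} (\<lambda>_. {}) Pow"
proof -
  have "card (Pow S) = 1 + card S + card (complete_pairs (\<lambda>_. {}) S)" if S: "S \<subseteq> V" for S
  proof -
    have fin: "finite S" and le: "card S \<le> 2"
      using S assms by (auto intro: finite_subset) (meson card_mono le_trans)
    have "complete_pairs (\<lambda>_. {}) S = (if card S = 2 then {S} else {})"
      using fin by (auto simp: complete_pairs_def nsets_def)
    then show ?thesis
      using le fin by (auto simp: card_Pow le_Suc_eq numeral_2_eq_2)
  qed
  moreover have "pattern_free V Pow"
    unfolding pattern_free_def
  proof (intro allI impI notI)
    fix S S' Z Z' :: "'a set" and i j k
    assume "S \<subseteq> V" "i \<in> S \<inter> S'" "j \<in> S \<inter> S'" "k \<in> S \<inter> S'" "i \<noteq> j"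
      and "i \<notin> Z \<and> j \<notin> Z \<and> k \<in> Z \<and> i \<in> Z' \<and> j \<in> Z' \<and> k \<notin> Z'"
    moreover from this have "i \<noteq> k" "j \<noteq> k" by auto
    ultimately have "{i, j, k} \<subseteq> V" "card {i, j, k} = 3" by auto
    then show False using card_mono[OF assms(1), of "{i, j, k}"] assms(2) by simp
  qed
  ultimately show ?thesis
    using assms(1) by (auto simp: realizes_def)
qed

section \<open>Joining two realizations along a partition\<close>

lemma nsets_disjoint_not_subset:
  assumes "V1 \<inter> V2 = {}" "e \<in> nsets V1 (Suc k)"
  shows "\<not> e \<subseteq> V2"
proof
  assume "e \<subseteq> V2"
  then have "e \<subseteq> V1 \<inter> V2" using assms(2) by (auto simp: nsets_def)
  then show False using assms by (simp add: nsets_def)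
qed

lemma count_cross_edges:
  assumes fin: "finite V1" "finite V2" and disj: "V1 \<inter> V2 = {}"
  shows "count (cross_edges V1 V2) e =
    (if e \<in> nsets V1 2 then card V2 else if e \<in> nsets V2 2 then card V1 else 0)"
proof -
  have fn: "finite (nsets V1 2)" "finite (nsets V2 2)"
    using fin by (simp_all add: finite_imp_finite_nsets)
  have "{x \<in> nsets V1 2 \<times> V2. (\<lambda>(e, w). e) x = e} = (if e \<in> nsets V1 2 then {e} \<times> V2 else {})"
    "{x \<in> V1 \<times> nsets V2 2. (\<lambda>(u, e). e) x = e} = (if e \<in> nsets V2 2 then V1 \<times> {e} else {})"
    by auto
  moreover have "e \<in> nsets V1 2 \<Longrightarrow> e \<notin> nsets V2 2"
    using nsets_disjoint_not_subset[OF disj, of e 1] by (auto simp: nsets_def numeral_2_eq_2)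
  ultimately show ?thesis
    using fin fn by (simp add: cross_edges_def count_image_mset_set card_cartesian_product)
qed

text \<open>Each triple meeting both parts chooses its pair inside one part. A pair inside a part
  therefore gains all vertices of the other part, and a pair across the parts is chosen by no
  triple.\<close>

definition join_pairs :: "'a set \<Rightarrow> 'a set \<Rightarrow> ('a set \<Rightarrow> 'a set) \<Rightarrow> ('a set \<Rightarrow> 'a set) \<Rightarrow> 'a set \<Rightarrow> 'a set" where
  "join_pairs V1 V2 N1 N2 e = (if e \<subseteq> V1 then N1 e \<union> V2 else if e \<subseteq> V2 then N2 e \<union> V1 else {})"

text \<open>If S has one vertex in each part, it is a complete pair although it crosses the parts.
  The general rule would then miss the pattern whose only 1 lies in V2; all four patterns are safe,
  since S contains no triple.\<close>

definition join_patterns ::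
  "'a set \<Rightarrow> 'a set \<Rightarrow> ('a set \<Rightarrow> 'a set set) \<Rightarrow> ('a set \<Rightarrow> 'a set set) \<Rightarrow> 'a set \<Rightarrow> 'a set set" where
  "join_patterns V1 V2 B1 B2 S =
     (if card (S \<inter> V1) = 1 \<and> card (S \<inter> V2) = 1 then Pow S
      else B1 (S \<inter> V1) \<union> (\<union>) (S \<inter> V1) ` B2 (S \<inter> V2))"

text \<open>A pair across the parts has empty \<open>join_pairs\<close>, so it is complete only in
  an S equal to itself, which \<open>big\<close> excludes. For a pair inside one part, the vertices
  of S in the other part impose no condition.\<close>

lemma complete_pairs_join:
  assumes disj: "V1 \<inter> V2 = {}" and S: "S \<subseteq> V1 \<union> V2" "finite S"
    and big: "\<not> (card (S \<inter> V1) = 1 \<and> card (S \<inter> V2) = 1)"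
  shows "complete_pairs (join_pairs V1 V2 N1 N2) S =
    complete_pairs N1 (S \<inter> V1) \<union> complete_pairs N2 (S \<inter> V2)"
proof (intro equalityI subsetI)
  fix e assume "e \<in> complete_pairs (join_pairs V1 V2 N1 N2) S"
  then have e: "e \<subseteq> S" "finite e" "card e = 2" "S - e \<subseteq> join_pairs V1 V2 N1 N2 e"
    by (auto simp: complete_pairs_def nsets_def)
  show "e \<in> complete_pairs N1 (S \<inter> V1) \<union> complete_pairs N2 (S \<inter> V2)"
  proof (cases "e \<subseteq> V1 \<or> e \<subseteq> V2")
    case True
    then show ?thesis
    proof
      assume "e \<subseteq> V1"
      then have "S \<inter> V1 - e \<subseteq> N1 e" using e(4) disj by (auto simp: join_pairs_def)
      then show ?thesis using e \<open>e \<subseteq> V1\<close> by (auto simp: complete_pairs_def nsets_def)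
    next
      assume "e \<subseteq> V2"
      then have "\<not> e \<subseteq> V1"
        using e disj nsets_disjoint_not_subset[of V2 V1 e 1] by (auto simp: nsets_def numeral_2_eq_2)
      then have "S \<inter> V2 - e \<subseteq> N2 e" using e(4) disj \<open>e \<subseteq> V2\<close> by (auto simp: join_pairs_def)
      then show ?thesis using e \<open>e \<subseteq> V2\<close> by (auto simp: complete_pairs_def nsets_def)
    qed
  next
    case False
    then have "S = e" using e by (auto simp: join_pairs_def)
    obtain x y where xy: "e = {x, y}" "x \<noteq> y" using e(3) by (auto simp: card_2_iff)
    then have "x \<in> V1 \<and> y \<in> V2 \<or> x \<in> V2 \<and> y \<in> V1"
      using False S \<open>S = e\<close> by auto
    then have "(\<exists>u. S \<inter> V1 = {u}) \<and> (\<exists>w. S \<inter> V2 = {w})"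
    proof
      assume "x \<in> V1 \<and> y \<in> V2"
      then have "S \<inter> V1 = {x}" "S \<inter> V2 = {y}" using disj unfolding \<open>S = e\<close> xy(1) by auto
      then show ?thesis by blast
    next
      assume "x \<in> V2 \<and> y \<in> V1"
      then have "S \<inter> V1 = {y}" "S \<inter> V2 = {x}" using disj unfolding \<open>S = e\<close> xy(1) by auto
      then show ?thesis by blast
    qed
    then show ?thesis using big by auto
  qed
next
  fix e assume "e \<in> complete_pairs N1 (S \<inter> V1) \<union> complete_pairs N2 (S \<inter> V2)"
  then show "e \<in> complete_pairs (join_pairs V1 V2 N1 N2) S"
  proof
    assume "e \<in> complete_pairs N1 (S \<inter> V1)"
    then show ?thesis using S disj
      by (auto simp: complete_pairs_def nsets_def join_pairs_def)
  next
    assume "e \<in> complete_pairs N2 (S \<inter> V2)"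
    then have e: "e \<subseteq> S" "e \<subseteq> V2" "finite e" "card e = 2" "S \<inter> V2 - e \<subseteq> N2 e"
      by (auto simp: complete_pairs_def nsets_def)
    then have "\<not> e \<subseteq> V1"
      using disj nsets_disjoint_not_subset[of V2 V1 e 1] by (auto simp: nsets_def numeral_2_eq_2)
    then show ?thesis using S e
      by (auto simp: complete_pairs_def nsets_def join_pairs_def)
  qed
qed

text \<open>The two halves of \<open>join_patterns\<close> share exactly the pattern
  \<open>S \<inter> V1\<close>, which compensates for the summand 1 occurring twice. Vertices and
  complete pairs add up over the parts. In the exceptional case the count is 4 = 1 + 2 + 1.\<close>

lemma card_join_patterns:
  assumes disj: "V1 \<inter> V2 = {}" and S: "S \<subseteq> V1 \<union> V2" "finite S"
    and B1: "B1 (S \<inter> V1) \<subseteq> Pow (S \<inter> V1)" "S \<inter> V1 \<in> B1 (S \<inter> V1)"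
      "card (B1 (S \<inter> V1)) = 1 + card (S \<inter> V1) + card (complete_pairs N1 (S \<inter> V1))"
    and B2: "B2 (S \<inter> V2) \<subseteq> Pow (S \<inter> V2)" "{} \<in> B2 (S \<inter> V2)"
      "card (B2 (S \<inter> V2)) = 1 + card (S \<inter> V2) + card (complete_pairs N2 (S \<inter> V2))"
  shows "card (join_patterns V1 V2 B1 B2 S) =
    1 + card S + card (complete_pairs (join_pairs V1 V2 N1 N2) S)"
proof (cases "card (S \<inter> V1) = 1 \<and> card (S \<inter> V2) = 1")
  case True
  then obtain u w where uw: "S \<inter> V1 = {u}" "S \<inter> V2 = {w}" by (auto simp: card_1_singleton_iff)
  then have Suw: "S = {u, w}" "u \<noteq> w" using S disj by auto
  have "complete_pairs (join_pairs V1 V2 N1 N2) S = {S}"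
    unfolding Suw(1) using Suw(2) by (auto simp: complete_pairs_def)
  then show ?thesis
    using True Suw by (simp add: join_patterns_def card_Pow)
next
  case False
  let ?A = "B1 (S \<inter> V1)" and ?C = "(\<union>) (S \<inter> V1) ` B2 (S \<inter> V2)"
  have cS: "card S = card (S \<inter> V1) + card (S \<inter> V2)"
    using S disj by (subst card_Un_disjoint[symmetric]) (auto intro: arg_cong[of _ _ card])
  have fin: "finite ?A" "finite ?C"
    using B1(1) B2(1) S(2) by (auto intro: finite_subset)
  have "?A \<inter> ?C = {S \<inter> V1}"
  proof (intro equalityI subsetI)
    fix Z assume "Z \<in> ?A \<inter> ?C"
    then obtain Y where "Z \<in> ?A" "Y \<in> B2 (S \<inter> V2)" "Z = (S \<inter> V1) \<union> Y" by blast
    then show "Z \<in> {S \<inter> V1}" using B1(1) B2(1) disj by auto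
  next
    fix Z assume "Z \<in> {S \<inter> V1}"
    then show "Z \<in> ?A \<inter> ?C" using B1(2) B2(2) by (auto intro!: image_eqI[of _ _ "{}"])
  qed
  moreover have "inj_on ((\<union>) (S \<inter> V1)) (B2 (S \<inter> V2))"
  proof (rule inj_onI)
    fix X Y assume "X \<in> B2 (S \<inter> V2)" "Y \<in> B2 (S \<inter> V2)" "S \<inter> V1 \<union> X = S \<inter> V1 \<union> Y"
    moreover from this have "X \<subseteq> V2" "Y \<subseteq> V2" using B2(1) by auto
    moreover from this have "X \<inter> V1 = {}" "Y \<inter> V1 = {}" using disj by auto
    ultimately show "X = Y" by blast
  qed
  ultimately have cU: "card (?A \<union> ?C) + 1 = card ?A + card (B2 (S \<inter> V2))"
    using card_Un_Int[OF fin] by (simp add: card_image)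
  have "complete_pairs N1 (S \<inter> V1) \<inter> complete_pairs N2 (S \<inter> V2) = {}"
    using nsets_disjoint_not_subset[OF disj, of _ 1]
    by (auto simp: complete_pairs_def nsets_def numeral_2_eq_2)
  moreover have "finite (complete_pairs N (S \<inter> W))" for N W
    using S(2) finite_imp_finite_nsets[of "S \<inter> W" 2] by (simp add: complete_pairs_def)
  ultimately have "card (complete_pairs (join_pairs V1 V2 N1 N2) S) =
      card (complete_pairs N1 (S \<inter> V1)) + card (complete_pairs N2 (S \<inter> V2))"
    unfolding complete_pairs_join[OF disj S False] by (simp add: card_Un_disjoint)
  moreover have "join_patterns V1 V2 B1 B2 S = ?A \<union> ?C"
    using False by (simp only: join_patterns_def if_False)
  ultimately show ?thesis using cU cS B1(3) B2(3) by simp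
qed

(* When |S| >= 3, a 1 in V2 forces 1s on all of S \<inter> V1. Two complementary patterns on a triple
   meeting both parts would violate this for one of them. *)
lemma pattern_free_join:
  assumes disj: "V1 \<inter> V2 = {}" and fin: "finite V1" "finite V2"
    and free: "pattern_free V1 B1" "pattern_free V2 B2"
    and B1: "\<And>S. S \<subseteq> V1 \<Longrightarrow> B1 S \<subseteq> Pow S \<and> S \<in> B1 S"
    and B2: "\<And>S. S \<subseteq> V2 \<Longrightarrow> B2 S \<subseteq> Pow S \<and> {} \<in> B2 S"
  shows "pattern_free (V1 \<union> V2) (join_patterns V1 V2 B1 B2)"
  unfolding pattern_free_def
proof (intro allI impI notI)
  fix S S' Z Z' i j k
  assume S: "S \<subseteq> V1 \<union> V2" "S' \<subseteq> V1 \<union> V2"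
    and Z: "Z \<in> join_patterns V1 V2 B1 B2 S" "Z' \<in> join_patterns V1 V2 B1 B2 S'"
    and mem: "i \<in> S \<inter> S'" "j \<in> S \<inter> S'" "k \<in> S \<inter> S'" and "i \<noteq> j"
    and bad: "i \<notin> Z \<and> j \<notin> Z \<and> k \<in> Z \<and> i \<in> Z' \<and> j \<in> Z' \<and> k \<notin> Z'"
  have main: "Y \<inter> V1 \<in> B1 (T \<inter> V1) \<and> Y \<inter> V2 \<in> B2 (T \<inter> V2) \<and>
      (\<forall>u\<in>T \<inter> V1. \<forall>w\<in>T \<inter> V2. w \<in> Y \<longrightarrow> u \<in> Y)"
    if T: "T \<subseteq> V1 \<union> V2" "Y \<in> join_patterns V1 V2 B1 B2 T" "{i, j, k} \<subseteq> T" for T Y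
  proof -
    have "finite T" using T(1) fin finite_subset by blast
    \<comment> \<open>T contains the three distinct rows i, j, k, so it avoids the exceptional case
      of \<open>join_patterns\<close>.\<close>
    have "\<not> (card (T \<inter> V1) = 1 \<and> card (T \<inter> V2) = 1)"
    proof
      assume "card (T \<inter> V1) = 1 \<and> card (T \<inter> V2) = 1"
      then have "card T \<le> 2"
        using card_Un_le[of "T \<inter> V1" "T \<inter> V2"] T(1) by (simp add: Int_Un_distrib[symmetric] Int_absorb2)
      moreover have "i \<noteq> k" "j \<noteq> k" using bad by auto
      then have "card {i, j, k} = 3" using \<open>i \<noteq> j\<close> by simp
      ultimately show False using card_mono[OF \<open>finite T\<close> T(3)] by simp
    qed
    then have "Y \<in> B1 (T \<inter> V1) \<or> (\<exists>X\<in>B2 (T \<inter> V2). Y = T \<inter> V1 \<union> X)"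
      using T(2) by (auto simp: join_patterns_def split: if_splits)
    then show ?thesis
    proof
      assume Y: "Y \<in> B1 (T \<inter> V1)"
      then have "Y \<subseteq> T \<inter> V1" using B1 by blast
      then have "Y \<inter> V1 = Y" "Y \<inter> V2 = {}" using disj by auto
      then show ?thesis using Y B2[of "T \<inter> V2"] by auto
    next
      assume "\<exists>X\<in>B2 (T \<inter> V2). Y = T \<inter> V1 \<union> X"
      then obtain X where X: "X \<in> B2 (T \<inter> V2)" "Y = T \<inter> V1 \<union> X" by blast
      then have "X \<subseteq> T \<inter> V2" using B2 by blast
      then have "Y \<inter> V1 = T \<inter> V1" "Y \<inter> V2 = X" using disj X by auto
      then show ?thesis using X B1[of "T \<inter> V1"] by auto
    qed
  qed
  have mS: "{i, j, k} \<subseteq> S" "{i, j, k} \<subseteq> S'" using mem by auto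
  note Z1 = main[OF S(1) Z(1) mS(1)] and Z2 = main[OF S(2) Z(2) mS(2)]
  have inV: "i \<in> V1 \<union> V2" "j \<in> V1 \<union> V2" "k \<in> V1 \<union> V2" using S mem by auto
  \<comment> \<open>On i, j, k the pattern Z' is the complement of Z, so the implication for Z' is
    the converse of the one for Z.\<close>
  have same: "(u \<in> Z) = (w \<in> Z)" if "u \<in> {i, j, k}" "w \<in> {i, j, k}" "u \<in> V1" "w \<in> V2" for u w
  proof -
    have "w \<in> Z \<longrightarrow> u \<in> Z" "w \<in> Z' \<longrightarrow> u \<in> Z'" using Z1 Z2 that mS by blast+
    moreover have "x \<in> Z' \<longleftrightarrow> x \<notin> Z" if "x \<in> {i, j, k}" for x using bad that by auto
    ultimately show ?thesis using that by blast
  qed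
  \<comment> \<open>Z contains k but neither i nor j, so by \<open>same\<close> the partition
    separates k from neither of them.\<close>
  consider "{i, j, k} \<subseteq> V1" | "{i, j, k} \<subseteq> V2"
    using same[of i k] same[of k i] same[of j k] same[of k j] inV bad by blast
  then show False
  proof cases
    case 1
    have *: "S \<inter> V1 \<subseteq> V1" "S' \<inter> V1 \<subseteq> V1" by auto
    have "i \<in> (S \<inter> V1) \<inter> (S' \<inter> V1)" "j \<in> (S \<inter> V1) \<inter> (S' \<inter> V1)" "k \<in> (S \<inter> V1) \<inter> (S' \<inter> V1)"
      using mem 1 by auto
    moreover have "i \<notin> Z \<inter> V1 \<and> j \<notin> Z \<inter> V1 \<and> k \<in> Z \<inter> V1 \<and> i \<in> Z' \<inter> V1 \<and> j \<in> Z' \<inter> V1 \<and> k \<notin> Z' \<inter> V1"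
      using bad 1 by auto
    ultimately show False
      using free(1)[unfolded pattern_free_def, rule_format, OF * _ _ _ _ _ \<open>i \<noteq> j\<close>] Z1 Z2 by blast
  next
    case 2
    have *: "S \<inter> V2 \<subseteq> V2" "S' \<inter> V2 \<subseteq> V2" by auto
    have "i \<in> (S \<inter> V2) \<inter> (S' \<inter> V2)" "j \<in> (S \<inter> V2) \<inter> (S' \<inter> V2)" "k \<in> (S \<inter> V2) \<inter> (S' \<inter> V2)"
      using mem 2 by auto
    moreover have "i \<notin> Z \<inter> V2 \<and> j \<notin> Z \<inter> V2 \<and> k \<in> Z \<inter> V2 \<and> i \<in> Z' \<inter> V2 \<and> j \<in> Z' \<inter> V2 \<and> k \<notin> Z' \<inter> V2"
      using bad 2 by auto
    ultimately show False
      using free(2)[unfolded pattern_free_def, rule_format, OF * _ _ _ _ _ \<open>i \<noteq> j\<close>] Z1 Z2 by blast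
  qed
qed

lemma realizes_join:
  assumes r1: "realizes V1 G1 N1 B1" and r2: "realizes V2 G2 N2 B2" and disj: "V1 \<inter> V2 = {}"
  shows "realizes (V1 \<union> V2) (G1 + G2 + cross_edges V1 V2) (join_pairs V1 V2 N1 N2)
    (join_patterns V1 V2 B1 B2)"
proof -
  let ?V = "V1 \<union> V2" and ?G = "G1 + G2 + cross_edges V1 V2"
  let ?N = "join_pairs V1 V2 N1 N2" and ?B = "join_patterns V1 V2 B1 B2"
  have fin: "finite V1" "finite V2" using r1 r2 by (auto simp: realizes_def)
  have G: "set_mset G1 \<subseteq> nsets V1 2" "set_mset G2 \<subseteq> nsets V2 2"
    using r1 r2 by (auto simp: realizes_def)
  have N1: "N1 e \<subseteq> V1 - e" "card (N1 e) = count G1 e" if "e \<in> nsets V1 2" for e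
    using r1 that by (auto simp: realizes_def)
  have N2: "N2 e \<subseteq> V2 - e" "card (N2 e) = count G2 e" if "e \<in> nsets V2 2" for e
    using r2 that by (auto simp: realizes_def)
  have B1: "B1 S \<subseteq> Pow S" "{} \<in> B1 S" "S \<in> B1 S" "card (B1 S) = 1 + card S + card (complete_pairs N1 S)"
    if "S \<subseteq> V1" for S
    using r1 that by (auto simp: realizes_def)
  have B2: "B2 S \<subseteq> Pow S" "{} \<in> B2 S" "S \<in> B2 S" "card (B2 S) = 1 + card S + card (complete_pairs N2 S)"
    if "S \<subseteq> V2" for S
    using r2 that by (auto simp: realizes_def)
  have excl: "e \<in> nsets V1 2 \<Longrightarrow> e \<notin> nsets V2 2" for e
    using nsets_disjoint_not_subset[OF disj, of e 1] by (auto simp: nsets_def numeral_2_eq_2)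
  \<comment> \<open>Since \<open>G1\<close> has edges inside \<open>V1\<close> only and
    \<open>G2\<close> inside \<open>V2\<close> only, each count vanishes on the pairs of the other
    part and on crossing pairs.\<close>
  have count: "count ?G e = (if e \<in> nsets V1 2 then count G1 e + card V2
      else if e \<in> nsets V2 2 then count G2 e + card V1 else 0)" for e
    using G excl[of e] count_cross_edges[OF fin disj, of e] by (auto simp: count_eq_zero_iff)
  have "set_mset ?G \<subseteq> nsets ?V 2"
  proof
    fix e assume "e \<in># ?G"
    then have "e \<in> nsets V1 2 \<or> e \<in> nsets V2 2"
      using count[of e] by (metis count_greater_zero_iff less_irrefl)
    then show "e \<in> nsets ?V 2" by (auto simp: nsets_def)
  qed
  moreover have "?N e \<subseteq> ?V - e \<and> card (?N e) = count ?G e" if e: "e \<in> nsets ?V 2" for e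
  proof -
    consider "e \<in> nsets V1 2" | "e \<in> nsets V2 2" "\<not> e \<subseteq> V1" | "\<not> e \<subseteq> V1" "\<not> e \<subseteq> V2"
      using e excl by (auto simp: nsets_def)
    then show ?thesis
    proof cases
      case 1
      then have "?N e = N1 e \<union> V2" "e \<subseteq> V1" by (auto simp: join_pairs_def nsets_def)
      moreover have "card (N1 e \<union> V2) = card (N1 e) + card V2"
        using N1(1)[OF 1] fin disj by (intro card_Un_disjoint) (auto intro: finite_subset)
      ultimately show ?thesis
        using N1[OF 1] 1 disj count[of e] by auto
    next
      case 2
      then have "?N e = N2 e \<union> V1" "e \<subseteq> V2" by (auto simp: join_pairs_def nsets_def)
      moreover have "card (N2 e \<union> V1) = card (N2 e) + card V1"
        using N2(1)[OF 2(1)] fin disj by (intro card_Un_disjoint) (auto intro: finite_subset)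
      moreover have "e \<notin> nsets V1 2" using 2 excl by blast
      ultimately show ?thesis
        using N2[OF 2(1)] 2 disj count[of e] by auto
    next
      case 3
      then show ?thesis using count[of e] by (auto simp: join_pairs_def nsets_def)
    qed
  qed
  moreover have "?B S \<subseteq> Pow S \<and> {} \<in> ?B S \<and> S \<in> ?B S \<and> card (?B S) = 1 + card S + card (complete_pairs ?N S)"
    if S: "S \<subseteq> ?V" for S
  proof -
    have fS: "finite S" using S fin finite_subset by blast
    note b1 = B1[of "S \<inter> V1", OF Int_lower2] and b2 = B2[of "S \<inter> V2", OF Int_lower2]
    have "S = S \<inter> V1 \<union> S \<inter> V2" using S by auto
    then have "S \<in> (\<union>) (S \<inter> V1) ` B2 (S \<inter> V2)" using b2(3) by (rule image_eqI)
    then have "?B S \<subseteq> Pow S \<and> {} \<in> ?B S \<and> S \<in> ?B S"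
      using b1(1,2) b2(1) unfolding join_patterns_def by auto
    then show ?thesis
      using card_join_patterns[where ?B1.0 = B1 and ?B2.0 = B2 and ?N1.0 = N1 and ?N2.0 = N2,
          OF disj S fS b1(1,3,4) b2(1,2,4)] by blast
  qed
  moreover have "pattern_free ?V ?B"
    using r1 r2 B1 B2 by (intro pattern_free_join[OF disj fin]) (simp_all add: realizes_def)
  ultimately show ?thesis
    using fin by (simp add: realizes_def)
qed

lemma two_recursive_realizable:
  assumes "two_recursive V G"
  shows "\<exists>N B. realizes V G N B"
  using assms
proof induction
  case (base V)
  then have "0 < card V" "card V \<le> 2" by auto
  then show ?case using realizes_small card_ge_0_finite by blast
next
  case (split V V1 V2 G1 G2 G)
  then obtain N1 B1 N2 B2 where "realizes V1 G1 N1 B1" "realizes V2 G2 N2 B2"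
    by (elim exE)
  from realizes_join[OF this split.hyps(3)] show ?case
    unfolding split.hyps(2,8) by (intro exI)
qed

section \<open>A 2-recursive TCM on \<open>{1..m}\<close> for m \<ge> 1, so that \<open>H2\<close>
  is the maximum of a nonempty set\<close>

definition max_TCM :: "nat \<Rightarrow> nat set multiset" where
  "max_TCM m = image_mset (\<lambda>T. T - {Max T}) (mset_set (nsets {1..m} 3))"

lemma is_TCM_max_TCM: "is_TCM {1..m} (max_TCM m)"
proof -
  have "T - {Max T} \<in> nsets T 2" if "T \<in> nsets {1..m} 3" for T
  proof -
    have "finite T" "card T = 3" using that by (auto simp: nsets_def)
    moreover from this have "Max T \<in> T" by (intro Max_in) auto
    ultimately show ?thesis by (auto simp: nsets_def)
  qed
  then show ?thesis
    unfolding is_TCM_def max_TCM_def by (intro conjI exI[of _ "\<lambda>T. T - {Max T}"]) simp_all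
qed

text \<open>Split off the largest vertex: each triple through \<open>Suc n\<close> chooses its other
  two vertices, and these pairs are the cross edges between \<open>{1..n}\<close> and the singleton.
  Two vertices form a base case, since \<open>split\<close> asks for three.\<close>

lemma two_recursive_max_TCM: "m \<ge> 1 \<Longrightarrow> two_recursive {1..m} (max_TCM m)"
proof (induction m rule: dec_induct)
  case base
  have "max_TCM 1 = {#}" by (simp add: max_TCM_def nsets_eq_empty)
  then show ?case using two_recursive.base[of "{1..1::nat}"] by simp
next
  case (step n)
  show ?case
  proof (cases "n = 1")
    case True
    have "max_TCM 2 = {#}" by (simp add: max_TCM_def nsets_eq_empty)
    then show ?thesis using two_recursive.base[of "{1..2::nat}"] True by (simp add: numeral_2_eq_2)
  next
    case False
    let ?v = "Suc n" and ?P = "nsets {1..n} 2"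
    have V: "{1..Suc n} = {1..n} \<union> {?v}" using step by auto
    have fin: "finite (nsets {1..n} k)" for k by (simp add: finite_imp_finite_nsets)
    have disj: "nsets {1..n} 3 \<inter> insert ?v ` ?P = {}" by (auto simp: nsets_def)
    have "nsets {1..Suc n} 3 = nsets {1..n} 3 \<union> insert ?v ` ?P"
    proof (intro equalityI subsetI)
      fix T assume T: "T \<in> nsets {1..Suc n} 3"
      show "T \<in> nsets {1..n} 3 \<union> insert ?v ` ?P"
      proof (cases "?v \<in> T")
        case True
        then have "T = insert ?v (T - {?v})" "T - {?v} \<in> ?P"
          using T by (auto simp: nsets_def le_Suc_eq)
        then show ?thesis by blast
      next
        case False
        then show ?thesis using T by (auto simp: nsets_def le_Suc_eq)
      qed
    next
      fix T assume "T \<in> nsets {1..n} 3 \<union> insert ?v ` ?P"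
      then show "T \<in> nsets {1..Suc n} 3"
        by (auto simp: nsets_def card_insert_if)
    qed
    then have "max_TCM (Suc n) = max_TCM n + image_mset (\<lambda>T. T - {Max T}) (mset_set (insert ?v ` ?P))"
      using fin disj by (simp add: max_TCM_def mset_set_Union)
    also have "mset_set (insert ?v ` ?P) = image_mset (insert ?v) (mset_set ?P)"
    proof (rule image_mset_mset_set[symmetric])
      show "inj_on (insert ?v) ?P"
      proof (rule inj_onI)
        fix a b assume "a \<in> ?P" "b \<in> ?P" "insert ?v a = insert ?v b"
        moreover from this have "?v \<notin> a" "?v \<notin> b" by (auto simp: nsets_def)
        ultimately show "a = b" by (metis insert_ident)
      qed
    qed
    also have "image_mset (\<lambda>T. T - {Max T}) (image_mset (insert ?v) (mset_set ?P)) = mset_set ?P"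
    proof -
      have "insert ?v e - {Max (insert ?v e)} = e" if "e \<in> ?P" for e
      proof -
        have "finite e" "\<forall>x\<in>e. x < ?v" using that by (auto simp: nsets_def)
        then have "Max (insert ?v e) = ?v" by (intro Max_eqI) auto
        then show ?thesis using \<open>\<forall>x\<in>e. x < ?v\<close> by auto
      qed
      then have "image_mset (\<lambda>e. insert ?v e - {Max (insert ?v e)}) (mset_set ?P) =
          image_mset (\<lambda>e. e) (mset_set ?P)"
        using fin by (intro image_mset_cong) simp
      then show ?thesis by (simp add: image_mset.compositionality comp_def)
    qed
    \<comment> \<open>The second summand of \<open>cross_edges\<close> is empty, since a singleton
      contains no pair.\<close>
    also have "mset_set ?P = cross_edges {1..n} {?v}"
    proof -
      have "?P \<times> {?v} = (\<lambda>e. (e, ?v)) ` ?P" by auto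
      then have "mset_set (?P \<times> {?v}) = image_mset (\<lambda>e. (e, ?v)) (mset_set ?P)"
        by (simp add: image_mset_mset_set inj_on_def)
      then show ?thesis
        by (simp add: cross_edges_def nsets_singleton_iff image_mset.compositionality comp_def)
    qed
    finally have G: "max_TCM (Suc n) = max_TCM n + {#} + cross_edges {1..n} {?v}" by simp
    show ?thesis
    proof (rule two_recursive.split[OF _ V _ _ _ _ _ G])
      show "3 \<le> card {1..Suc n}" using False step(1) by simp
      show "{1..n} \<inter> {?v} = {}" "{1..n} \<noteq> {}" "{?v} \<noteq> {}" using step(1) by auto
      show "two_recursive {1..n} (max_TCM n)" by (rule step.IH)
      show "two_recursive {?v} {#}" by (rule two_recursive.base) simp
    qed
  qed
qed

subsection \<open>The upper bound\<close>

text \<open>These are the patterns seen on T among the words whose binary support contains T. A word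
  with another symbol on T cannot take part in M on these rows.\<close>

definition binary_traces :: "'a set \<Rightarrow> ('a \<Rightarrow> nat) set \<Rightarrow> 'a set set" where
  "binary_traces T \<F> = ones T ` {f \<in> \<F>. \<forall>v\<in>T. f v \<le> 1}"

lemma binary_traces_iff:
  "X \<in> binary_traces T \<F> \<longleftrightarrow> (\<exists>f\<in>\<F>. (\<forall>v\<in>T. f v \<le> 1) \<and> ones T f = X)"
  by (auto simp: binary_traces_def)

lemma binary_traces_subset: "binary_traces T \<F> \<subseteq> Pow T"
  by (auto simp: binary_traces_def ones_def)

text \<open>The six subsets of T other than \<open>{}\<close> and T form three complementary pairs,
  each a singleton with its complement. Both members of a pair would give M, so at most three of the
  six occur, plus \<open>{}\<close> and T.\<close>

lemma card_binary_traces_le_5: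
  assumes free: "M_free V \<F>" and T: "T \<in> nsets V 3"
  shows "card (binary_traces T \<F>) \<le> 5"
proof -
  let ?tr = "binary_traces T \<F>"
  have T': "T \<subseteq> V" "finite T" "card T = 3" using T by (auto simp: nsets_def)
  have single: "T - {k} \<notin> ?tr" if kt: "{k} \<in> ?tr" for k
  proof
    assume "T - {k} \<in> ?tr"
    then obtain g where g: "g \<in> \<F>" "\<forall>v\<in>T. g v \<le> 1" "ones T g = T - {k}"
      unfolding binary_traces_iff by blast
    obtain f where f: "f \<in> \<F>" "\<forall>v\<in>T. f v \<le> 1" "ones T f = {k}"
      using kt unfolding binary_traces_iff by blast
    have k: "k \<in> T" using f(3) by (auto simp: ones_def)
    then have "card (T - {k}) = 2" using T' by simp
    then obtain i j where ij: "T - {k} = {i, j}" "i \<noteq> j" by (auto simp: card_2_iff)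
    then have mem: "i \<in> T" "j \<in> T" "i \<noteq> k" "j \<noteq> k" by auto
    have fv: "f v = 1 \<longleftrightarrow> v = k" "g v = 1 \<longleftrightarrow> v \<noteq> k" if "v \<in> T" for v
      using f(3) g(3) that by (auto simp: ones_def set_eq_iff)
    have "f i = 0" "f j = 0" "f k = 1" "g i = 1" "g j = 1" "g k = 0"
      using fv[of i] fv[of j] fv[of k] mem k f(2) g(2) by (auto simp: le_Suc_eq)
    then show False
      using free f(1) g(1) mem k T'(1) ij(2) unfolding M_free_def by blast
  qed
  let ?A = "?tr - {{}, T}"
  have comp: "T - X \<notin> ?tr" if "X \<in> ?A" for X
  proof -
    have "X \<subseteq> T" using that binary_traces_subset by blast
    then have "card X \<le> 3" using card_mono[OF T'(2)] T'(3) by metis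
    moreover have "card X \<noteq> 0" using that finite_subset[OF \<open>X \<subseteq> T\<close> T'(2)] by simp
    moreover have "card X \<noteq> 3" using that card_subset_eq[OF T'(2) \<open>X \<subseteq> T\<close>] T'(3) by auto
    ultimately consider "card X = 1" | "card X = 2" by linarith
    then show ?thesis
    proof cases
      case 1
      then obtain k where "X = {k}" by (auto simp: card_1_singleton_iff)
      then show ?thesis using single that by auto
    next
      case 2
      then have "card (T - X) = 1"
        using T' \<open>X \<subseteq> T\<close> by (simp add: card_Diff_subset finite_subset)
      then obtain k where "T - X = {k}" by (auto simp: card_1_singleton_iff)
      moreover from this have "X = T - {k}" using \<open>X \<subseteq> T\<close> by auto
      ultimately show ?thesis using single[of k] that by auto
    qed
  qed
  have fin: "finite (Pow T)" "finite ?A"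
    using T'(2) finite_subset[OF binary_traces_subset[of T \<F>]] by simp_all
  have inj: "inj_on ((-) T) ?A"
    using binary_traces_subset[of T \<F>] by (intro inj_on_inverseI[of _ "(-) T"]) (auto simp: double_diff)
  have "?A \<inter> (-) T ` ?A = {}"
  proof (intro equals0I)
    fix Y assume "Y \<in> ?A \<inter> (-) T ` ?A"
    then obtain X where "X \<in> ?A" "T - X \<in> ?tr" by blast
    then show False using comp by blast
  qed
  then have "card (?A \<union> (-) T ` ?A) = card ?A + card ((-) T ` ?A)"
    by (rule card_Un_disjoint[OF fin(2) finite_imageI[OF fin(2)]])
  then have "card ?A + card ?A = card (?A \<union> (-) T ` ?A)"
    unfolding card_image[OF inj] by simp
  also have "\<dots> \<le> card (Pow T - {{}, T})"
  proof (rule card_mono)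
    show "finite (Pow T - {{}, T})" using fin by simp
    show "?A \<union> (-) T ` ?A \<subseteq> Pow T - {{}, T}"
      using binary_traces_subset[of T \<F>] by auto
  qed
  also have "\<dots> = 6"
  proof -
    have "T \<noteq> {}" using T'(3) by auto
    then have "card {{}, T} = 2" by simp
    then show ?thesis
      using T' by (subst card_Diff_subset) (auto simp: card_Pow)
  qed
  finally have "card ?A \<le> 3" by simp
  moreover have "card ?tr \<le> card (?A \<union> {{}, T})"
    using fin by (intro card_mono) auto
  moreover have "card (?A \<union> {{}, T}) \<le> card ?A + card {{}, T}" by (rule card_Un_le)
  moreover have "card {{}, T} \<le> 2" by (simp add: card_insert_if)
  ultimately show ?thesis by linarith
qed

section \<open>Shifting 1s down to 0s\<close>

definition down_shift :: "'a \<Rightarrow> ('a \<Rightarrow> nat) set \<Rightarrow> ('a \<Rightarrow> nat) \<Rightarrow> 'a \<Rightarrow> nat" where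
  "down_shift v \<F> f = (if f v = 1 \<and> f(v := 0) \<notin> \<F> then f(v := 0) else f)"

text \<open>A changed word lies outside the family, hence differs from every unchanged one. Two
  changed words both had a 1 at v, so they are recovered from their images.\<close>

lemma inj_on_down_shift: "inj_on (down_shift v \<F>) \<F>"
proof (rule inj_onI)
  fix f g assume fg: "f \<in> \<F>" "g \<in> \<F>" and eq: "down_shift v \<F> f = down_shift v \<F> g"
  show "f = g"
  proof (cases "(f v = 1 \<and> f(v := 0) \<notin> \<F>) \<and> (g v = 1 \<and> g(v := 0) \<notin> \<F>)")
    case True
    then have "f(v := 0) = g(v := 0)" "f v = g v" using eq by (simp_all add: down_shift_def)
    then show ?thesis by (metis fun_upd_triv fun_upd_upd)
  next
    case False
    then show ?thesis using eq fg by (auto simp: down_shift_def split: if_splits)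
  qed
qed

text \<open>Traces are shifted by the same rule as words, and an image has no more elements than its
  source. A changed word has its old trace without v, which is either an old trace, fixed by the
  map, or the image of one. An unchanged word with a 1 at v has its copy with a 0 there in the
  family, so the map fixes its trace.\<close>

lemma binary_traces_down_shift:
  "binary_traces T (down_shift v \<F> ` \<F>) \<subseteq>
    (\<lambda>X. if v \<in> X \<and> X - {v} \<notin> binary_traces T \<F> then X - {v} else X) ` binary_traces T \<F>"
  (is "_ \<subseteq> ?s ` ?tr")
proof
  fix Y assume "Y \<in> binary_traces T (down_shift v \<F> ` \<F>)"
  then obtain f where f: "f \<in> \<F>" "\<forall>u\<in>T. down_shift v \<F> f u \<le> 1" "Y = ones T (down_shift v \<F> f)"
    by (auto simp: binary_traces_def)
  have "f u \<le> 1" if "u \<in> T" for u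
    using f(2) that by (cases "u = v") (auto simp: down_shift_def split: if_splits)
  then have X: "ones T f \<in> ?tr" using f(1) by (auto simp: binary_traces_def)
  show "Y \<in> ?s ` ?tr"
  proof (cases "f v = 1 \<and> f(v := 0) \<notin> \<F>")
    case True
    then have Y: "Y = ones T f - {v}" by (auto simp: f(3) down_shift_def ones_def)
    show ?thesis
    proof (cases "Y \<in> ?tr")
      case True
      then show ?thesis using Y by (intro image_eqI[of _ _ Y]) auto
    next
      case False
      then show ?thesis using X Y by (intro image_eqI[of _ _ "ones T f"]) auto
    qed
  next
    case False
    then have Y: "Y = ones T f" by (simp only: f(3) down_shift_def if_False)
    have "ones T f - {v} \<in> ?tr" if "v \<in> ones T f"
    proof -
      have "f(v := 0) \<in> \<F>" using that False by (auto simp: ones_def)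
      moreover have "ones T (f(v := 0)) = ones T f - {v}" by (auto simp: ones_def)
      moreover have "\<forall>u\<in>T. (f(v := 0)) u \<le> 1" using \<open>\<And>u. u \<in> T \<Longrightarrow> f u \<le> 1\<close> by auto
      ultimately show ?thesis unfolding binary_traces_iff by (intro bexI conjI)
    qed
    then show ?thesis using X Y by (intro image_eqI[of _ _ "ones T f"]) auto
  qed
qed

text \<open>Induction on the total number of 1s. A violation of closedness at v lets
  \<open>down_shift\<close> lower this number strictly, while the size of the family and the bound
  on the traces persist.\<close>

lemma ex_down_closed_family:
  assumes V: "finite V" and sub: "\<F> \<subseteq> words V r"
    and tr: "\<forall>T\<in>nsets V 3. card (binary_traces T \<F>) \<le> b"
  shows "\<exists>\<D>\<subseteq>words V r. card \<D> = card \<F> \<and> (\<forall>T\<in>nsets V 3. card (binary_traces T \<D>) \<le> b) \<and>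
    (\<forall>f\<in>\<D>. \<forall>v\<in>V. f v = 1 \<longrightarrow> f(v := 0) \<in> \<D>)"
  using sub tr
proof (induction \<F> rule: measure_induct_rule[where f = "\<lambda>\<F>. \<Sum>f\<in>\<F>. card (ones V f)"])
  case (less \<F>)
  show ?case
  proof (cases "\<forall>f\<in>\<F>. \<forall>v\<in>V. f v = 1 \<longrightarrow> f(v := 0) \<in> \<F>")
    case True
    show ?thesis
    proof (intro exI conjI)
      show "\<F> \<subseteq> words V r" by (rule less.prems(1))
      show "\<forall>T\<in>nsets V 3. card (binary_traces T \<F>) \<le> b" by (rule less.prems(2))
    qed (rule refl, rule True)
  next
    case False
    then obtain f v where fv: "f \<in> \<F>" "v \<in> V" "f v = 1" "f(v := 0) \<notin> \<F>" by blast
    let ?s = "down_shift v \<F>"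
    have fin: "finite \<F>" using less.prems(1) V finite_words finite_subset by blast
    have ones_s: "ones V (?s g) \<subseteq> ones V g" for g
      by (auto simp: down_shift_def ones_def)
    have fin_ones: "finite (ones V g)" for g using V by (simp add: ones_def)
    have "(\<Sum>g\<in>?s ` \<F>. card (ones V g)) = (\<Sum>g\<in>\<F>. card (ones V (?s g)))"
      by (simp add: sum.reindex[OF inj_on_down_shift])
    also have "\<dots> < (\<Sum>g\<in>\<F>. card (ones V g))"
    proof (rule sum_strict_mono_ex1[OF fin])
      show "\<forall>g\<in>\<F>. card (ones V (?s g)) \<le> card (ones V g)"
        using ones_s fin_ones by (simp add: card_mono)
      have "v \<in> ones V f" "v \<notin> ones V (?s f)" using fv by (auto simp: ones_def down_shift_def)
      then have "ones V (?s f) \<subset> ones V f" using ones_s by blast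
      then show "\<exists>g\<in>\<F>. card (ones V (?s g)) < card (ones V g)"
        using fv(1) fin_ones psubset_card_mono by blast
    qed
    finally have dec: "(\<Sum>g\<in>?s ` \<F>. card (ones V g)) < (\<Sum>g\<in>\<F>. card (ones V g))" .
    have sub': "?s ` \<F> \<subseteq> words V r"
    proof
      fix h assume "h \<in> ?s ` \<F>"
      then obtain g where g: "g \<in> words V r" "h = ?s g" using less.prems(1) by blast
      then show "h \<in> words V r"
        using fv(2) by (auto simp: down_shift_def words_def PiE_def Pi_def extensional_def)
    qed
    have tr': "\<forall>T\<in>nsets V 3. card (binary_traces T (?s ` \<F>)) \<le> b"
    proof
      fix T assume T: "T \<in> nsets V 3"
      have "finite (binary_traces T \<F>)" using fin by (simp add: binary_traces_def)
      then have "card (binary_traces T (?s ` \<F>)) \<le> card (binary_traces T \<F>)"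
        using binary_traces_down_shift by (rule surj_card_le)
      also have "\<dots> \<le> b" using less.prems(2) T by (rule bspec)
      finally show "card (binary_traces T (?s ` \<F>)) \<le> b" .
    qed
    have cs: "card (?s ` \<F>) = card \<F>" by (rule card_image[OF inj_on_down_shift])
    from less.IH[OF dec sub' tr'] show ?thesis unfolding cs .
  qed
qed

section \<open>Down-closed families and the TCM they determine\<close>

lemma binary_traces_down_closed:
  assumes closed: "\<forall>f\<in>\<D>. \<forall>v\<in>V. f v = 1 \<longrightarrow> f(v := 0) \<in> \<D>" and "T \<subseteq> V" "finite T"
    and X: "X \<in> binary_traces T \<D>" and "Y \<subseteq> X"
  shows "Y \<in> binary_traces T \<D>"
proof -
  have "X \<subseteq> T" using X binary_traces_subset by blast
  then have "finite X" using assms(3) finite_subset by blast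
  \<comment> \<open>Closedness removes a single 1, so the elements of \<open>X - Y\<close> are
    deleted one at a time.\<close>
  have "X - W \<in> binary_traces T \<D>" if "finite W" "W \<subseteq> X" for W
    using that
  proof (induction W rule: finite_induct)
    case empty
    then show ?case using X by simp
  next
    case (insert w W)
    then obtain f where f: "f \<in> \<D>" "\<forall>v\<in>T. f v \<le> 1" "ones T f = X - W"
      by (auto simp: binary_traces_def)
    then have "w \<in> ones T f" using insert by auto
    then have "f(w := 0) \<in> \<D>" using closed f(1) \<open>T \<subseteq> V\<close> by (auto simp: ones_def)
    moreover have "ones T (f(w := 0)) = X - insert w W" using f(3) by (auto simp: ones_def)
    moreover have "\<forall>v\<in>T. (f(w := 0)) v \<le> 1" using f(2) by simp
    ultimately show ?case by (force simp: binary_traces_def)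
  qed
  from this[of "X - Y"] show ?thesis
    using \<open>finite X\<close> \<open>Y \<subseteq> X\<close> by (simp add: double_diff)
qed

text \<open>T would bring all its 8 subsets. Two distinct pairs share at most one vertex, so
  together they would bring at least 4 + 4 - 2 = 6 subsets. Both exceed 5.\<close>

lemma down_closed_small_traces:
  assumes T: "finite T" "card T = 3" and sub: "\<A> \<subseteq> Pow T" and card: "card \<A> \<le> 5"
    and down: "\<And>X Y. X \<in> \<A> \<Longrightarrow> Y \<subseteq> X \<Longrightarrow> Y \<in> \<A>"
  shows "T \<notin> \<A>" and "\<exists>e\<in>nsets T 2. \<forall>e'\<in>nsets T 2. e' \<in> \<A> \<longrightarrow> e' = e"
proof -
  have fin: "finite \<A>" using sub T(1) by (auto intro: finite_subset)
  show "T \<notin> \<A>"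
  proof
    assume "T \<in> \<A>"
    then have "Pow T \<subseteq> \<A>" using down by auto
    then have "card (Pow T) \<le> 5" using card_mono[OF fin] card by (meson le_trans)
    then show False using T by (simp add: card_Pow)
  qed
  have uniq: "X = Y" if XY: "X \<in> nsets T 2" "Y \<in> nsets T 2" "X \<in> \<A>" "Y \<in> \<A>" for X Y
  proof (rule ccontr)
    assume "X \<noteq> Y"
    have X: "finite X" "card X = 2" "X \<subseteq> T" and Y: "finite Y" "card Y = 2" "Y \<subseteq> T"
      using XY by (auto simp: nsets_def)
    have "X \<inter> Y \<noteq> X"
      using \<open>X \<noteq> Y\<close> X Y card_subset_eq[of Y X] by auto
    then have "card (X \<inter> Y) < 2"
      using X psubset_card_mono[of X "X \<inter> Y"] by auto
    moreover have "card (Pow (X \<inter> Y)) = 2 ^ card (X \<inter> Y)"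
      using X by (intro card_Pow) simp
    ultimately have "card (Pow (X \<inter> Y)) \<le> 2"
      by (auto simp: less_2_cases_iff simp del: Pow_Int_eq)
    moreover have "card (Pow X) + card (Pow Y) = card (Pow X \<union> Pow Y) + card (Pow (X \<inter> Y))"
      using card_Un_Int[of "Pow X" "Pow Y"] X Y unfolding Pow_Int_eq by simp
    moreover have "card (Pow X \<union> Pow Y) \<le> card \<A>"
      using down XY by (intro card_mono[OF fin]) auto
    ultimately show False using card X Y by (simp add: card_Pow)
  qed
  \<comment> \<open>If no pair lies in \<open>\<A>\<close>, any pair of T can serve as the
    choice.\<close>
  have "nsets T 2 \<noteq> {}"
    using T by (simp add: nsets_eq_empty_iff)
  then show "\<exists>e\<in>nsets T 2. \<forall>e'\<in>nsets T 2. e' \<in> \<A> \<longrightarrow> e' = e"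
    using uniq by (metis (no_types, lifting) ex_in_conv)
qed

text \<open>Here c chooses on each triple the only pair that may be a trace. Three 1s in a word
  would make a whole triple a trace of itself, so a word has at most two 1s.\<close>

lemma down_closed_family_pattern:
  assumes V: "finite V" and sub: "\<D> \<subseteq> words V r"
    and tr: "\<forall>T\<in>nsets V 3. card (binary_traces T \<D>) \<le> 5"
    and closed: "\<forall>f\<in>\<D>. \<forall>v\<in>V. f v = 1 \<longrightarrow> f(v := 0) \<in> \<D>"
  obtains c where "\<forall>T\<in>nsets V 3. c T \<in> nsets T 2"
    "\<D> \<subseteq> pattern_words V r (\<lambda>S. {X. X \<subseteq> S \<and> card X \<le> 1} \<union>
       complete_pairs (\<lambda>e. {w \<in> V - e. c (insert w e) = e}) S)"
proof -
  have small: "T \<notin> binary_traces T \<D> \<and>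
      (\<exists>e\<in>nsets T 2. \<forall>e'\<in>nsets T 2. e' \<in> binary_traces T \<D> \<longrightarrow> e' = e)"
    if "T \<in> nsets V 3" for T
  proof -
    have T: "finite T" "card T = 3" "T \<subseteq> V" using that by (auto simp: nsets_def)
    have "card (binary_traces T \<D>) \<le> 5" using tr that by blast
    moreover have "Y \<in> binary_traces T \<D>" if "X \<in> binary_traces T \<D>" "Y \<subseteq> X" for X Y
      using binary_traces_down_closed[OF closed T(3,1) that] .
    ultimately show ?thesis
      using down_closed_small_traces[OF T(1,2) binary_traces_subset] by blast
  qed
  then have "\<forall>T\<in>nsets V 3. \<exists>e. e \<in> nsets T 2 \<and> (\<forall>e'\<in>nsets T 2. e' \<in> binary_traces T \<D> \<longrightarrow> e' = e)"
    by blast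
  then obtain c where c: "\<forall>T\<in>nsets V 3. c T \<in> nsets T 2 \<and>
      (\<forall>e'\<in>nsets T 2. e' \<in> binary_traces T \<D> \<longrightarrow> e' = c T)"
    by (rule bchoice[THEN exE])
  have "\<D> \<subseteq> pattern_words V r (\<lambda>S. {X. X \<subseteq> S \<and> card X \<le> 1} \<union>
       complete_pairs (\<lambda>e. {w \<in> V - e. c (insert w e) = e}) S)"
  proof
    fix f assume f: "f \<in> \<D>"
    let ?Z = "ones V f" and ?S = "binary_support V f"
    have ZS: "?Z \<subseteq> ?S" "finite ?Z" "?S \<subseteq> V"
      using V by (auto simp: ones_def binary_support_def)
    have trace: "?Z \<inter> T \<in> binary_traces T \<D>" if "T \<subseteq> ?S" for T
    proof -
      have "ones T f = ?Z \<inter> T" "\<forall>v\<in>T. f v \<le> 1"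
        using that ZS(3) by (auto simp: ones_def binary_support_def)
      then show ?thesis using f by (force simp: binary_traces_def)
    qed
    have "card ?Z \<le> 2"
    proof (rule ccontr)
      assume "\<not> card ?Z \<le> 2"
      then obtain T where T: "T \<subseteq> ?Z" "card T = 3" "finite T"
        using obtain_subset_with_card_n[of 3 ?Z] by auto
      then have "T \<in> nsets V 3" using ZS by (auto simp: nsets_def)
      moreover have "T \<in> binary_traces T \<D>"
        using trace[of T] T(1) ZS(1) by (simp add: Int_absorb1)
      ultimately show False using small by blast
    qed
    have "?Z \<in> {X. X \<subseteq> ?S \<and> card X \<le> 1} \<union>
        complete_pairs (\<lambda>e. {w \<in> V - e. c (insert w e) = e}) ?S"
    proof (cases "card ?Z = 2")
      case True
      \<comment> \<open>A word with 1s exactly on \<open>?Z\<close> and a 0 at w shows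
        \<open>?Z\<close> as a trace on the triple \<open>insert w ?Z\<close>, which must then
        choose it.\<close>
      have "c (insert w ?Z) = ?Z" if w: "w \<in> ?S - ?Z" for w
      proof -
        have "insert w ?Z \<in> nsets V 3" using w True ZS by (auto simp: nsets_def)
        moreover have "?Z \<in> nsets (insert w ?Z) 2" using True ZS by (auto simp: nsets_def)
        moreover have "?Z \<in> binary_traces (insert w ?Z) \<D>"
          using trace[of "insert w ?Z"] w ZS(1) by (simp add: Int_absorb2 subset_insertI)
        ultimately show ?thesis using c by metis
      qed
      then show ?thesis using True ZS by (auto simp: complete_pairs_def nsets_def)
    next
      case False
      then show ?thesis using \<open>card ?Z \<le> 2\<close> ZS(1) by auto
    qed
    then show "f \<in> pattern_words V r (\<lambda>S. {X. X \<subseteq> S \<and> card X \<le> 1} \<union>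
       complete_pairs (\<lambda>e. {w \<in> V - e. c (insert w e) = e}) S)"
      using f sub by (auto simp: pattern_words_def)
  qed
  then show thesis using that c by blast
qed

text \<open>A triple that chooses e contains e, so it is \<open>insert w e\<close> for exactly one
  w. This supplies the sets \<open>N e\<close> of the counting formula.\<close>

lemma count_choice_edges:
  assumes V: "finite V" and c: "\<forall>T\<in>nsets V 3. c T \<in> nsets T 2" and e: "e \<in> nsets V 2"
  shows "count (image_mset c (mset_set (nsets V 3))) e = card {w \<in> V - e. c (insert w e) = e}"
proof -
  have e': "e \<subseteq> V" "finite e" "card e = 2" using e by (auto simp: nsets_def)
  have "{T \<in> nsets V 3. c T = e} = (\<lambda>w. insert w e) ` {w \<in> V - e. c (insert w e) = e}"
  proof (intro equalityI subsetI)
    fix T assume "T \<in> {T \<in> nsets V 3. c T = e}"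
    then have T: "T \<in> nsets V 3" "c T = e" "finite T" "card T = 3" "T \<subseteq> V"
      by (auto simp: nsets_def)
    then have "e \<subseteq> T" using c by (auto simp: nsets_def)
    then have "card (T - e) = 1" using T e' by (simp add: card_Diff_subset)
    then obtain w where w: "T - e = {w}" by (auto simp: card_1_singleton_iff)
    then have "T = insert w e" using \<open>e \<subseteq> T\<close> by auto
    then show "T \<in> (\<lambda>w. insert w e) ` {w \<in> V - e. c (insert w e) = e}"
      using w T by auto
  next
    fix T assume "T \<in> (\<lambda>w. insert w e) ` {w \<in> V - e. c (insert w e) = e}"
    then show "T \<in> {T \<in> nsets V 3. c T = e}" using e' by (auto simp: nsets_def)
  qed
  moreover have "inj_on (\<lambda>w. insert w e) {w \<in> V - e. c (insert w e) = e}"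
    by (intro inj_onI) auto
  ultimately show ?thesis
    using V by (simp add: count_image_mset_set finite_imp_finite_nsets card_image)
qed

text \<open>The number agrees with the one demanded in \<open>realizes\<close>, so the same formula
  evaluates both bounds.\<close>

lemma card_small_or_complete_pairs:
  assumes "finite S"
  shows "card ({X. X \<subseteq> S \<and> card X \<le> 1} \<union> complete_pairs N S) = 1 + card S + card (complete_pairs N S)"
proof -
  let ?P = "{X. X \<subseteq> S \<and> card X \<le> 1}"
  have P: "?P = insert {} ((\<lambda>x. {x}) ` S)"
    using assms by (auto simp: le_Suc_eq card_1_singleton_iff finite_subset)
  have "card (insert {} ((\<lambda>x. {x}) ` S)) = 1 + card S"
    using assms by (subst card_insert_disjoint) (auto simp: card_image)
  then have "card ?P = 1 + card S" unfolding P .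
  moreover have "finite (complete_pairs N S)" "finite ?P"
    using assms by (simp_all add: complete_pairs_def finite_imp_finite_nsets)
  moreover have "?P \<inter> complete_pairs N S = {}"
    by (auto simp: complete_pairs_def nsets_def)
  ultimately show ?thesis by (simp only: card_Un_disjoint)
qed

section \<open>The maxima \<open>H\<close> and \<open>H2\<close>\<close>

lemma finite_TCMs:
  assumes "finite V"
  shows "finite {G. is_TCM V G}"
proof (rule finite_subset)
  let ?P = "PiE (nsets V 3) (\<lambda>T. nsets V 2)"
  show "finite ((\<lambda>c. image_mset c (mset_set (nsets V 3))) ` ?P)"
    using assms by (intro finite_imageI finite_PiE finite_imp_finite_nsets)
  show "{G. is_TCM V G} \<subseteq> (\<lambda>c. image_mset c (mset_set (nsets V 3))) ` ?P"
  proof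
    fix G assume "G \<in> {G. is_TCM V G}"
    then obtain c where c: "\<forall>T\<in>nsets V 3. c T \<in> nsets T 2" "G = image_mset c (mset_set (nsets V 3))"
      by (auto simp: is_TCM_def)
    have "nsets T 2 \<subseteq> nsets V 2" if "T \<in> nsets V 3" for T
      using that by (intro nsets_mono) (simp add: nsets_def)
    \<comment> \<open>Values of c off the triples do not affect G, so c may be taken from the finite
      set of extensional choices.\<close>
    then have "restrict c (nsets V 3) \<in> ?P" using c(1) by auto
    moreover have "image_mset (restrict c (nsets V 3)) (mset_set (nsets V 3)) = G"
      unfolding c(2) using assms by (intro image_mset_cong) (simp add: finite_imp_finite_nsets)
    ultimately show "G \<in> (\<lambda>c. image_mset c (mset_set (nsets V 3))) ` ?P" by (metis image_eqI)
  qed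
qed

lemma weight_le_1: "m \<le> 1 \<Longrightarrow> weight m G \<alpha> = 0"
  by (simp add: weight_def nsets_eq_empty)

lemma weight_le_H:
  assumes "is_TCM {1..m} G"
  shows "weight m G \<alpha> \<le> H m \<alpha>"
proof (cases "m \<le> 1")
  case True
  then show ?thesis by (simp add: H_def weight_le_1)
next
  case False
  have "{weight m G \<alpha> | G. is_TCM {1..m} G} = (\<lambda>G. weight m G \<alpha>) ` {G. is_TCM {1..m} G}" by blast
  then have "finite {weight m G \<alpha> | G. is_TCM {1..m} G}" by (simp add: finite_TCMs)
  then show ?thesis unfolding H_def using False assms by (auto intro!: Max_ge)
qed

text \<open>For m \<le> 1 both \<open>H2\<close> and every weight are 0, so the empty multigraph
  serves. This includes m = 0, where no 2-recursive TCM exists.\<close>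

lemma H2_attained:
  obtains G N B where "H2 m \<alpha> = weight m G \<alpha>" "realizes {1..m} G N B"
proof (cases "m \<le> 1")
  case True
  then have "realizes {1..m} {#} (\<lambda>_. {}) Pow" by (intro realizes_small) auto
  moreover have "H2 m \<alpha> = weight m {#} \<alpha>" using True by (simp add: H2_def weight_le_1)
  ultimately show thesis using that by blast
next
  case False
  let ?S = "{weight m G \<alpha> | G. is_TCM {1..m} G \<and> two_recursive {1..m} G}"
  have "?S \<subseteq> (\<lambda>G. weight m G \<alpha>) ` {G. is_TCM {1..m} G}" by blast
  then have "finite ?S" by (rule finite_subset) (simp add: finite_TCMs)
  moreover have "?S \<noteq> {}"
    using is_TCM_max_TCM[of m] two_recursive_max_TCM[of m] False by auto
  ultimately have "Max ?S \<in> ?S" by (rule Max_in)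
  then obtain G where G: "H2 m \<alpha> = weight m G \<alpha>" "two_recursive {1..m} G"
    using False by (auto simp: H2_def)
  from two_recursive_realizable[OF G(2)] show thesis
    using that G(1) by blast
qed

text \<open>Integer powers keep m - 1 and m - 2 from being truncated at 0. For m = 0 the factor m
  removes the term with exponent -1, and for m \<le> 1 both \<open>H2\<close> and \<open>H\<close>
  are 0.\<close>

theorem theorem1p5:
  fixes m r :: nat
  assumes "r \<ge> 3"
  shows "H2 m ((real r - 1) / (real r - 2)) * (real r - 2) powi (int m - 2)
           \<le> real (forb m r conf_M) - (real r - 1) ^ m - real m * (real r - 1) powi (int m - 1)
       \<and> real (forb m r conf_M) - (real r - 1) ^ m - real m * (real r - 1) powi (int m - 1)
           \<le> H m ((real r - 1) / (real r - 2)) * (real r - 2) powi (int m - 2)"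
proof
  let ?\<alpha> = "(real r - 1) / (real r - 2)" and ?V = "{1..m}"
  obtain G N B where G: "H2 m ?\<alpha> = weight m G ?\<alpha>" and real: "realizes ?V G N B"
    by (rule H2_attained)
  have "real (card (pattern_words ?V r B)) =
      (real r - 1) ^ m + real m * (real r - 1) powi (int m - 1) +
      weight m G ?\<alpha> * (real r - 2) powi (int m - 2)"
    using card_pattern_words_complete_pairs[of ?V r B N "count G"] real assms
    by (simp add: realizes_def weight_def)
  moreover have "card (pattern_words ?V r B) \<le> forb m r conf_M"
    using real by (intro le_forb_conf_M M_free_pattern_words) (auto simp: realizes_def pattern_words_def)
  ultimately show "H2 m ?\<alpha> * (real r - 2) powi (int m - 2)
      \<le> real (forb m r conf_M) - (real r - 1) ^ m - real m * (real r - 1) powi (int m - 1)"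
    unfolding G by simp
next
  let ?\<alpha> = "(real r - 1) / (real r - 2)" and ?V = "{1..m}"
  obtain \<F> where F: "\<F> \<subseteq> words ?V r" "M_free ?V \<F>" "card \<F> = forb m r conf_M"
    using forb_conf_M_attained by blast
  have fin: "finite ?V" by simp
  have tr5: "\<forall>T\<in>nsets ?V 3. card (binary_traces T \<F>) \<le> 5"
    by (intro ballI card_binary_traces_le_5[OF F(2)])
  obtain \<D> where D: "\<D> \<subseteq> words ?V r" "card \<D> = card \<F>"
      "\<forall>T\<in>nsets ?V 3. card (binary_traces T \<D>) \<le> 5"
      "\<forall>f\<in>\<D>. \<forall>v\<in>?V. f v = 1 \<longrightarrow> f(v := 0) \<in> \<D>"
    using ex_down_closed_family[OF fin F(1) tr5] by (elim exE conjE) (rule that)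
  obtain c where c: "\<forall>T\<in>nsets ?V 3. c T \<in> nsets T 2"
    and sub: "\<D> \<subseteq> pattern_words ?V r (\<lambda>S. {X. X \<subseteq> S \<and> card X \<le> 1} \<union>
       complete_pairs (\<lambda>e. {w \<in> ?V - e. c (insert w e) = e}) S)"
    by (rule down_closed_family_pattern[OF fin D(1,3,4)])
  let ?N = "\<lambda>e. {w \<in> ?V - e. c (insert w e) = e}"
  let ?B = "\<lambda>S. {X. X \<subseteq> S \<and> card X \<le> 1} \<union> complete_pairs ?N S"
  let ?G = "image_mset c (mset_set (nsets ?V 3))"
  have G: "is_TCM ?V ?G" using c fin unfolding is_TCM_def by (intro conjI exI[of _ c]) simp_all
  have "finite (pattern_words ?V r ?B)"
    by (rule finite_subset[of _ "words ?V r"]) (auto simp: pattern_words_def)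
  then have "forb m r conf_M \<le> card (pattern_words ?V r ?B)"
    using card_mono[OF _ sub] D(2) F(3) by simp
  moreover have "real (card (pattern_words ?V r ?B)) =
      (real r - 1) ^ card ?V + real (card ?V) * (real r - 1) powi (int (card ?V) - 1) +
      (\<Sum>e\<in>nsets ?V 2. ?\<alpha> ^ count ?G e) * (real r - 2) powi (int (card ?V) - 2)"
  proof (rule card_pattern_words_complete_pairs[OF fin assms])
    show "?B S \<subseteq> Pow S" for S by (auto simp: complete_pairs_def nsets_def)
    show "card (?B S) = 1 + card S + card (complete_pairs ?N S)" if "S \<subseteq> ?V" for S
      using that by (intro card_small_or_complete_pairs) (auto intro: finite_subset)
    show "?N e \<subseteq> ?V - e" for e by blast
    show "card (?N e) = count ?G e" if "e \<in> nsets ?V 2" for e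
      using count_choice_edges[OF fin c that] by simp
  qed
  then have "real (card (pattern_words ?V r ?B)) =
      (real r - 1) ^ m + real m * (real r - 1) powi (int m - 1) +
      weight m ?G ?\<alpha> * (real r - 2) powi (int m - 2)"
    by (simp add: weight_def)
  moreover have "weight m ?G ?\<alpha> * (real r - 2) powi (int m - 2) \<le> H m ?\<alpha> * (real r - 2) powi (int m - 2)"
    using weight_le_H[OF G] assms by (intro mult_right_mono) (auto intro: zero_le_power_int)
  ultimately show "real (forb m r conf_M) - (real r - 1) ^ m - real m * (real r - 1) powi (int m - 1)
      \<le> H m ?\<alpha> * (real r - 2) powi (int m - 2)"
    by linarith
qed

end
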